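(* Let $\lambda,l,m>0$. In the exponential model, suppose that $\alpha$ and $\beta$ are the uniform distributions on $[\lambda/2,\lambda/2+l]$ and $[\lambda/2,\lambda/2+m]$, respectively. Then, for $s,t>0$, the shape function is given by $$\begin{aligned}g(s,t)&=\frac sl\log\left(1+\frac l\lambda+\frac l\lambda\cdot\frac{lt-ms+\sqrt{(lt-ms)^2+4st(\lambda+l)(\lambda+m)}}{2s(\lambda+m)}\right)\\&\quad+\frac tm\log\left(1+\frac m\lambda+\frac m\lambda\cdot\frac{ms-lt+\sqrt{(lt-ms)^2+4st(\lambda+l)(\lambda+m)}}{2t(\lambda+l)}\right).\end{aligned}$$
   Context: Let $\mathbb N=\{1,2,\dots\}$. Exponential model: Let $\mathbf a=(a_n)_{n\in\mathbb N}$ and $\mathbf b=(b_n)_{n\in\mathbb N}$ be stationary random sequences with terms in $(0,\infty)$, with joint distribution $\mu$. Let $\tau_k$ denote the shift $(c_n)_{n\in\mathbb N}\mapsto(c_{n+k})_{n\in\mathbb N}$. It is assumed that $\mu$ is totally ergodic: for each $k,l\in\mathbb N$ separately, $\mu$ is (stationary and) ergodic under $\tau_k\times\tau_l$, which acts by $(\mathbf a,\mathbf b)\mapsto(\tau_k\mathbf a,\tau_l\mathbf b)$. Given $(\mathbf a,\mathbf b)$, the weights $\{W(i,j):i,j\in\mathbb N\}$ are independent under the conditional law $\mathbf P_{\mathbf a,\mathbf b}$ with $\mathbf P_{\mathbf a,\mathbf b}(W(i,j)\ge x)=e^{-(a_i+b_j)x}$ for $x\ge0$. Let $\mathbb P(\cdot)=\int\mathbf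 P_{\mathbf a,\mathbf b}(\cdot)\,\mu(d\mathbf a,d\mathbf b)$ be the unconditional law of the weights. Last-passage times: $G(m,n)=\max_\pi\sum_{(i,j)\in\pi}W(i,j)$, the maximum being over all directed paths $\pi$ from $(1,1)$ to $(m,n)$ in $\mathbb Z^2$ (finite sequences of sites with steps in $\{(1,0),(0,1)\}$). Shape function: $g:(0,\infty)^2\to[0,\infty]$ is the deterministic function such that, $\mathbb P$-a.s., $\lim_{n\to\infty}n^{-1}G(\lfloor ns\rfloor,\lfloor nt\rfloor)=g(s,t)$ for all $s,t>0$ (such a function exists). $\alpha$ and $\beta$ denote the distributions of $a_1$ and $b_1$. *)

theory Defs
  imports "HOL-Probability.Probability"
begin

text \<open>
  Sequences are indexed by the positive integers \<open>{1..}\<close> and sites by \<open>{1..} \<times> {1..}\<close>; following the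
  library's convention for product measures, they are extensional functions, that is, equal to
  \<^term>\<open>undefined\<close> outside these index sets.
\<close>

definition pos_seq_space :: "(nat \<Rightarrow> real) measure" where
  "pos_seq_space = PiM {1..} (\<lambda>_. restrict_space borel {0<..})"

definition env_space :: "((nat \<Rightarrow> real) \<times> (nat \<Rightarrow> real)) measure" where
  "env_space = pos_seq_space \<Otimes>\<^sub>M pos_seq_space"

definition shift :: "nat \<Rightarrow> (nat \<Rightarrow> real) \<Rightarrow> (nat \<Rightarrow> real)" where
  "shift k c = (\<lambda>n\<in>{1..}. c (n + k))"

definition measure_preserving_map :: "'a measure \<Rightarrow> ('a \<Rightarrow> 'a) \<Rightarrow> bool" where
  "measure_preserving_map M T \<longleftrightarrow> T \<in> M \<rightarrow>\<^sub>M M \<and> distr M M T = M"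

definition ergodic_map :: "'a measure \<Rightarrow> ('a \<Rightarrow> 'a) \<Rightarrow> bool" where
  "ergodic_map M T \<longleftrightarrow> measure_preserving_map M T \<and>
     (\<forall>A\<in>sets M. T -` A \<inter> space M = A \<longrightarrow> measure M A = 0 \<or> measure M A = 1)"

text \<open>
  Each map \<open>\<tau>\<^sub>k \<times> \<tau>\<^sub>l\<close> has to be ergodic on its own; this is stronger than ergodicity of
  the action generated by all of them. Stationarity of the two sequences is the
  measure-preservation part.
\<close>

definition totally_ergodic :: "((nat \<Rightarrow> real) \<times> (nat \<Rightarrow> real)) measure \<Rightarrow> bool" where
  "totally_ergodic \<mu> \<longleftrightarrow> (\<forall>k\<ge>1. \<forall>l\<ge>1. ergodic_map \<mu> (map_prod (shift k) (shift l)))"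

definition exponential_model :: "((nat \<Rightarrow> real) \<times> (nat \<Rightarrow> real)) measure \<Rightarrow> bool" where
  "exponential_model \<mu> \<longleftrightarrow> prob_space \<mu> \<and> sets \<mu> = sets env_space \<and> totally_ergodic \<mu>"

definition row_marginal :: "((nat \<Rightarrow> real) \<times> (nat \<Rightarrow> real)) measure \<Rightarrow> real measure" where
  "row_marginal \<mu> = distr \<mu> borel (\<lambda>(a, b). a 1)"

definition column_marginal :: "((nat \<Rightarrow> real) \<times> (nat \<Rightarrow> real)) measure \<Rightarrow> real measure" where
  "column_marginal \<mu> = distr \<mu> borel (\<lambda>(a, b). b 1)"

definition weight_space :: "(nat \<times> nat \<Rightarrow> real) measure" where
  "weight_space = PiM ({1..} \<times> {1..}) (\<lambda>_. borel)"

definition exponential_distribution :: "real \<Rightarrow> real measure" where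
  "exponential_distribution r = density lborel (exponential_density r)"

definition quenched_law :: "(nat \<Rightarrow> real) \<Rightarrow> (nat \<Rightarrow> real) \<Rightarrow> (nat \<times> nat \<Rightarrow> real) measure" where
  "quenched_law a b = PiM ({1..} \<times> {1..}) (\<lambda>(i, j). exponential_distribution (a i + b j))"

definition annealed_law :: "((nat \<Rightarrow> real) \<times> (nat \<Rightarrow> real)) measure \<Rightarrow> (nat \<times> nat \<Rightarrow> real) measure" where
  "annealed_law \<mu> = \<mu> \<bind> (\<lambda>(a, b). quenched_law a b)"

definition lattice_step :: "nat \<times> nat \<Rightarrow> nat \<times> nat \<Rightarrow> bool" where
  "lattice_step p q \<longleftrightarrow> q = (fst p + 1, snd p) \<or> q = (fst p, snd p + 1)"

definition directed_paths :: "nat \<Rightarrow> nat \<Rightarrow> (nat \<times> nat) list set" where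
  "directed_paths m n =
     {\<pi>. \<pi> \<noteq> [] \<and> hd \<pi> = (1, 1) \<and> last \<pi> = (m, n) \<and> successively lattice_step \<pi>}"

text \<open>
  For \<open>m = 0\<close> or \<open>n = 0\<close> there is no path and the value is unspecified; for fixed \<open>s, t > 0\<close> this
  concerns only finitely many \<open>n\<close> in the limit below.
\<close>

definition last_passage :: "(nat \<times> nat \<Rightarrow> real) \<Rightarrow> nat \<Rightarrow> nat \<Rightarrow> real" where
  "last_passage W m n = Max ((\<lambda>\<pi>. \<Sum>p\<leftarrow>\<pi>. W p) ` directed_paths m n)"

text \<open>Only the values on \<open>(0,\<infinity>)\<^sup>2\<close> matter.\<close>

definition is_shape_function ::
    "((nat \<Rightarrow> real) \<times> (nat \<Rightarrow> real)) measure \<Rightarrow> (real \<Rightarrow> real \<Rightarrow> ereal) \<Rightarrow> bool" where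
  "is_shape_function \<mu> g \<longleftrightarrow> (\<forall>s>0. \<forall>t>0. 0 \<le> g s t) \<and>
     (AE W in annealed_law \<mu>. \<forall>s>0. \<forall>t>0.
        (\<lambda>n. ereal (last_passage W (nat \<lfloor>real n * s\<rfloor>) (nat \<lfloor>real n * t\<rfloor>) / real n))
          \<longlonglongrightarrow> g s t)"

lemma space_pos_seq_space: "space pos_seq_space = (\<Pi>\<^sub>E i\<in>{1..}. {0<..})"
  by (simp add: pos_seq_space_def space_PiM space_restrict_space)

lemma sets_exponential_distribution [simp]: "sets (exponential_distribution r) = sets borel"
  by (simp add: exponential_distribution_def)

lemma space_exponential_distribution [simp]: "space (exponential_distribution r) = UNIV"
  by (simp add: exponential_distribution_def)

lemma prob_space_exponential_distribution:
  assumes "r > 0" shows "prob_space (exponential_distribution r)"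
  unfolding exponential_distribution_def by (rule prob_space_exponential_density[OF assms])

lemma exponential_distribution_tail:
  assumes r: "r > 0" and x: "x \<ge> 0"
  shows "measure (exponential_distribution r) {x..} = exp (- r * x)"
proof -
  interpret prob_space "density lborel (exponential_density r)"
    using prob_space_exponential_density[OF r] .
  have D: "distributed (density lborel (exponential_density r)) lborel (\<lambda>x. x) (exponential_density r)"
    by (auto simp: distributed_def distr_id2)
  have "measure (exponential_distribution r) {x..}
      = measure (density lborel (exponential_density r)) {x..}"
    by (simp add: exponential_distribution_def)
  also have "\<dots> = measure (density lborel (exponential_density r)) {x<..}"
  proof (rule finite_measure_eq_AE)
    have "AE y in lborel. y \<noteq> x" by (rule AE_lborel_singleton)
    then show "AE y in density lborel (exponential_density r). (y \<in> {x..}) = (y \<in> {x<..})"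
      by (subst AE_density) (auto elim!: eventually_mono)
  qed auto
  also have "\<dots> = exp (- r * x)"
    using exponential_distributedD_gt[OF D x r] by (simp add: greaterThan_def mult.commute)
  finally show ?thesis .
qed

lemma quenched_law_measurable:
  "(\<lambda>(a, b). quenched_law a b) \<in> env_space \<rightarrow>\<^sub>M prob_algebra weight_space"
proof (rule measurable_prob_algebraI)
  have pos: "a i + b j > 0" if "(a, b) \<in> space env_space" "i \<ge> 1" "j \<ge> 1" for a b i j
    using that unfolding env_space_def space_pair_measure space_pos_seq_space
    by (auto simp: PiE_iff intro!: add_pos_pos)
  then have ps: "prob_space (case p of (i, j) \<Rightarrow> exponential_distribution (a i + b j))"
    if "(a, b) \<in> space env_space" "p \<in> {1..} \<times> {1..}" for a b p
    using that by (auto intro!: prob_space_exponential_distribution)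
  have P: "prob_space (quenched_law a b)" if "(a, b) \<in> space env_space" for a b
    unfolding quenched_law_def using ps[OF that] by (intro prob_space_PiM) auto
  then show "prob_space (case x of (a, b) \<Rightarrow> quenched_law a b)" if "x \<in> space env_space" for x
    using that P by (cases x) auto
  have S: "sets (quenched_law a b) = sets weight_space" for a b
    unfolding quenched_law_def weight_space_def by (rule sets_PiM_cong) auto
  let ?I = "{1..} \<times> {1..} :: (nat \<times> nat) set"
  let ?B = "\<lambda>_ :: nat \<times> nat. borel :: real measure"
  have comp1: "(\<lambda>a. a i) \<in> pos_seq_space \<rightarrow>\<^sub>M borel" if "i \<ge> 1" for i
    using measurable_component_singleton[of i "{1..}" "\<lambda>_. restrict_space borel {0<..}"] that
    unfolding pos_seq_space_def by (auto simp: measurable_restrict_space2_iff)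
  show "(\<lambda>(a, b). quenched_law a b) \<in> env_space \<rightarrow>\<^sub>M subprob_algebra weight_space"
  proof (rule measurable_subprob_algebra_generated)
    show "sets weight_space = sigma_sets (\<Pi>\<^sub>E i\<in>?I. space (?B i)) (prod_algebra ?I ?B)"
      unfolding weight_space_def by (rule sets_PiM)
    show "Int_stable (prod_algebra ?I ?B)" by (rule Int_stable_prod_algebra)
    show "prod_algebra ?I ?B \<subseteq> Pow (\<Pi>\<^sub>E i\<in>?I. space (?B i))"
      by (rule prod_algebra_sets_into_space)
    show "subprob_space (case x of (a, b) \<Rightarrow> quenched_law a b)" if "x \<in> space env_space" for x
      using that P by (cases x) (auto intro: prob_space_imp_subprob_space)
    show "sets (case x of (a, b) \<Rightarrow> quenched_law a b) = sets weight_space" for x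
      using S by (cases x) auto
    have meas: "(\<lambda>x. emeasure (case x of (a, b) \<Rightarrow> quenched_law a b) A) \<in> borel_measurable env_space"
      if "A \<in> prod_algebra ?I ?B" for A
    proof -
      from prod_algebraE[OF that] obtain J E where
        A: "A = prod_emb ?I ?B J (\<Pi>\<^sub>E j\<in>J. E j)" and J: "finite J" "J \<subseteq> ?I"
        and E: "\<And>i. i \<in> J \<Longrightarrow> E i \<in> sets borel" by metis
      have eq: "emeasure (case x of (a, b) \<Rightarrow> quenched_law a b) A
         = (\<Prod>p\<in>J. \<integral>\<^sup>+ w. ennreal (exponential_density (fst x (fst p) + snd x (snd p)) w)
              * indicator (E p) w \<partial>lborel)"
        if x: "x \<in> space env_space" for x
      proof -
        obtain a b where ab: "x = (a, b)" by (cases x)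
        let ?M = "\<lambda>p. case p of (i, j) \<Rightarrow> exponential_distribution (a i + b j)"
        have "A = prod_emb ?I ?M J (\<Pi>\<^sub>E j\<in>J. E j)"
          unfolding A prod_emb_def by (auto split: prod.splits)
        then have "emeasure (quenched_law a b) A = (\<Prod>p\<in>J. emeasure (?M p) (E p))"
          unfolding quenched_law_def
          using emeasure_PiM_emb[of ?I ?M J E] ps x ab J E by (auto split: prod.splits)
        also have "\<dots> = (\<Prod>p\<in>J. \<integral>\<^sup>+ w. ennreal (exponential_density (a (fst p) + b (snd p)) w)
              * indicator (E p) w \<partial>lborel)"
          using E by (intro prod.cong refl)
            (auto simp: exponential_distribution_def emeasure_density split: prod.splits)
        finally show ?thesis by (simp add: ab)
      qed
      have "(\<lambda>x. \<Prod>p\<in>J. \<integral>\<^sup>+ w. ennreal (exponential_density (fst x (fst p) + snd x (snd p)) w)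
              * indicator (E p) w \<partial>lborel) \<in> borel_measurable env_space"
      proof (rule borel_measurable_prod_ennreal)
        fix p assume p: "p \<in> J"
        have [measurable]: "(\<lambda>x. fst x (fst p)) \<in> borel_measurable env_space"
          "(\<lambda>x. snd x (snd p)) \<in> borel_measurable env_space"
          using p J comp1 unfolding env_space_def
          by (auto intro!: measurable_compose[OF measurable_fst] measurable_compose[OF measurable_snd])
        have [measurable]: "E p \<in> sets borel" using E p by auto
        show "(\<lambda>x. \<integral>\<^sup>+ w. ennreal (exponential_density (fst x (fst p) + snd x (snd p)) w)
              * indicator (E p) w \<partial>lborel) \<in> borel_measurable env_space"
          unfolding exponential_density_def by measurable
      qed
      then show ?thesis by (subst measurable_cong[OF eq])
    qed
    then show "\<And>A. A \<in> prod_algebra ?I ?B \<Longrightarrow>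
        (\<lambda>x. emeasure (case x of (a, b) \<Rightarrow> quenched_law a b) A) \<in> borel_measurable env_space" .
    show "(\<lambda>x. emeasure (case x of (a, b) \<Rightarrow> quenched_law a b) (\<Pi>\<^sub>E i\<in>?I. space (?B i)))
        \<in> borel_measurable env_space"
      by (rule meas) (rule space_in_prod_algebra)
  qed
qed

lemma emeasure_annealed_law:
  assumes "prob_space \<mu>" "sets \<mu> = sets env_space" "A \<in> sets weight_space"
  shows "emeasure (annealed_law \<mu>) A = (\<integral>\<^sup>+ (a, b). emeasure (quenched_law a b) A \<partial>\<mu>)"
proof -
  have K: "(\<lambda>(a, b). quenched_law a b) \<in> \<mu> \<rightarrow>\<^sub>M subprob_algebra weight_space"
    using measurable_prob_algebraD[OF quenched_law_measurable] assms(2)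
    by (simp cong: measurable_cong_sets)
  have "space \<mu> \<noteq> {}" using assms(1) by (rule prob_space.not_empty)
  from emeasure_bind[OF this K assms(3)] show ?thesis
    by (simp add: annealed_law_def case_prod_beta')
qed

lemma directed_paths_finite_nonempty:
  assumes "m \<ge> 1" "n \<ge> 1"
  shows "finite (directed_paths m n)" "directed_paths m n \<noteq> {}"
proof -
  have len: "fst (hd \<pi>) + snd (hd \<pi>) + length \<pi> = fst (last \<pi>) + snd (last \<pi>) + 1"
    if "\<pi> \<noteq> []" "successively lattice_step \<pi>" for \<pi>
    using that by (induction \<pi> rule: induct_list012) (auto simp: lattice_step_def)
  have bd: "fst p \<le> fst (last \<pi>) \<and> snd p \<le> snd (last \<pi>)"
    if "p \<in> set \<pi>" "successively lattice_step \<pi>" for \<pi> p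
    using that
  proof (induction \<pi> arbitrary: p rule: induct_list012)
    case (3 x y zs)
    have succ: "successively lattice_step (y # zs)" and xy: "lattice_step x y"
      using "3.prems" by simp_all
    have IH: "fst q \<le> fst (last (y # zs)) \<and> snd q \<le> snd (last (y # zs))"
      if "q \<in> set (y # zs)" for q using "3.IH"(2) that succ by blast
    have "fst x \<le> fst y \<and> snd x \<le> snd y" using xy by (auto simp: lattice_step_def)
    then have "fst x \<le> fst (last (y # zs)) \<and> snd x \<le> snd (last (y # zs))"
      using IH[of y] by simp
    moreover have "p = x \<or> p \<in> set (y # zs)" using "3.prems" by auto
    moreover have "last (x # y # zs) = last (y # zs)" by simp
    ultimately show ?case using IH by metis
  qed auto
  have "directed_paths m n \<subseteq> {\<pi>. set \<pi> \<subseteq> {..m} \<times> {..n} \<and> length \<pi> \<le> m + n}"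
    using len bd by (fastforce simp: directed_paths_def)
  then show "finite (directed_paths m n)"
    by (rule finite_subset) (intro finite_lists_length_le finite_cartesian_product finite_atMost)
  have row: "directed_paths (Suc k) 1 \<noteq> {}" for k
  proof (induction k)
    case 0 have "[(1, 1)] \<in> directed_paths (Suc 0) 1" by (simp add: directed_paths_def)
    then show ?case by blast
  next
    case (Suc k)
    then obtain \<pi> where "\<pi> \<in> directed_paths (Suc k) 1" by blast
    then have "\<pi> @ [(Suc (Suc k), 1)] \<in> directed_paths (Suc (Suc k)) 1"
      by (auto simp: directed_paths_def successively_append_iff lattice_step_def)
    then show ?case by blast
  qed
  have "directed_paths (Suc k) (Suc j) \<noteq> {}" for k j
  proof (induction j)
    case 0 then show ?case using row by simp
  next
    case (Suc j)
    then obtain \<pi> where "\<pi> \<in> directed_paths (Suc k) (Suc j)" by blast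
    then have "\<pi> @ [(Suc k, Suc (Suc j))] \<in> directed_paths (Suc k) (Suc (Suc j))"
      by (auto simp: directed_paths_def successively_append_iff lattice_step_def)
    then show ?case by blast
  qed
  from this[of "m - 1" "n - 1"] show "directed_paths m n \<noteq> {}" using assms by simp
qed

end

theory Submission
  imports Defs
begin

text \<open>
  For \<open>z\<close> in \<open>(-lam/2, lam/2)\<close> let \<open>f z = s E(1/(a\<^sub>1 + z)) + t E(1/(b\<^sub>1 - z))\<close>. The shape function is the
  minimum of \<open>f\<close>. For uniform marginals \<open>f\<close> is a sum of two logarithms that is infinite at both ends
  of the interval, so that the minimum is at an interior critical point, the solution of a quadratic
  equation; its value is the asserted formula.

  The function \<open>f\<close> is the growth rate of a stationary version of the model. Attach an additional row
  and column to the quadrant, with parameters \<open>a\<^sub>0 = -z\<close> and \<open>b\<^sub>0 = z\<close>, so that the sites on the axes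
  have exponential weights of rates \<open>a\<^sub>i + z\<close> and \<open>b\<^sub>j - z\<close>. By Burke's property
  (\<open>burke_corner\<close>, \<open>burke_column\<close>) the increments of the last-passage time along every column are
  distributed as the independent weights on the axis. Hence the last-passage time \<open>G\<^sub>z\<close> is a sum of two
  sums of independent exponentials, and \<open>G\<^sub>z(ns, nt) / n\<close> tends to \<open>f z\<close> in probability for almost every
  environment, since the averages of \<open>1/(a\<^sub>i + z)\<close> and \<open>1/(b\<^sub>j - z)\<close> converge by the ergodic theorem
  (\<open>birkhoff_ergodic\<close>).

  As \<open>G \<le> G\<^sub>z\<close>, the shape function is at most \<open>f z\<close> for every \<open>z\<close>. For the converse let \<open>z\<close> be critical
  and couple the stationary models for all parameters through one field of unit exponentials. If the
  geodesic of \<open>G\<^sub>z\<close> used more than \<open>\<epsilon> n\<close> sites of the horizontal axis, then lowering \<open>z\<close> to \<open>z'\<close>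
  would increase the weight of this path by about \<open>\<epsilon> n (A z' - A z)\<close>, where \<open>A z = E(1/(a\<^sub>1 + z))\<close>. This is
  of first order in \<open>z - z'\<close>, but \<open>f z' - f z\<close> is of smaller order, so for \<open>z'\<close> close to \<open>z\<close> the
  resulting path would be too long for \<open>G\<^sub>z\<^sub>'\<close>. The same holds on the vertical axis with a larger
  parameter. Hence the geodesic leaves the axes after at most \<open>\<epsilon> n\<close> sites, and \<open>G\<close> differs from \<open>G\<^sub>z\<close>
  by at most the boundary weights on these sites (\<open>lpp_tilt\<close>, \<open>quenched_bounds\<close>). Letting \<open>\<epsilon>\<close> tend
  to zero gives \<open>f z\<close> as a lower bound (\<open>shape_at_critical_point\<close>).
\<close>

section \<open>Birkhoff's theorem for bounded functions\<close>

text \<open>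
  \<open>max_partial_sum T f n x\<close> is the maximum of the partial sums \<open>0, S\<^sub>1 x, \<dots>, S\<^sub>n x\<close> of
  \<open>f\<close> along the orbit of \<open>x\<close>. The recursion is the one that Garsia's argument uses.
\<close>

fun max_partial_sum :: "('a \<Rightarrow> 'a) \<Rightarrow> ('a \<Rightarrow> real) \<Rightarrow> nat \<Rightarrow> 'a \<Rightarrow> real" where
  "max_partial_sum T f 0 x = 0"
| "max_partial_sum T f (Suc n) x = max 0 (f x + max_partial_sum T f n (T x))"

lemma max_partial_sum_measurable:
  assumes [measurable]: "T \<in> M \<rightarrow>\<^sub>M M" "f \<in> borel_measurable M"
  shows "max_partial_sum T f n \<in> borel_measurable M"
proof (induction n)
  case (Suc n)
  note Suc [measurable]
  have "max_partial_sum T f (Suc n) = (\<lambda>x. max 0 (f x + max_partial_sum T f n (T x)))" by auto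
  then show ?case by simp
qed simp

lemma max_partial_sum_nonneg: "0 \<le> max_partial_sum T f n x"
  by (cases n) auto

lemma max_partial_sum_mono: "max_partial_sum T f n x \<le> max_partial_sum T f (Suc n) x"
proof (induction n arbitrary: x)
  case (Suc n)
  show ?case using Suc[of "T x"] by simp
qed simp

lemma max_partial_sum_le: "(\<And>x. \<bar>f x\<bar> \<le> B) \<Longrightarrow> max_partial_sum T f n x \<le> real n * B"
proof (induction n arbitrary: x)
  case (Suc n)
  have "0 \<le> B" using Suc.prems[of x] by linarith
  then show ?case using Suc.IH[OF Suc.prems, of "T x"] Suc.prems[of x]
    by (auto simp: algebra_simps abs_le_iff intro: add_nonneg_nonneg)
qed simp

lemma birkhoff_sum_Suc:
  fixes f :: "'a \<Rightarrow> real"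
  shows "(\<Sum>i<Suc n. f ((T ^^ i) x)) = f x + (\<Sum>i<n. f ((T ^^ i) (T x)))"
  by (subst sum.lessThan_Suc_shift) (simp add: funpow_swap1)

lemma birkhoff_sum_le_max: "(\<Sum>i<n. f ((T ^^ i) x)) \<le> max_partial_sum T f n x"
proof (induction n arbitrary: x)
  case (Suc n)
  show ?case using Suc[of "T x"] by (simp add: birkhoff_sum_Suc del: sum.lessThan_Suc)
qed simp

text \<open>
  Where the maximum \<open>R\<^sub>n\<close> is positive, the recursion and monotonicity in \<open>n\<close> give
  \<open>f \<ge> R\<^sub>n - R\<^sub>n \<circ> T\<close>; elsewhere \<open>R\<^sub>n = 0 \<le> R\<^sub>n \<circ> T\<close>. The right-hand side has integral zero
  because \<open>T\<close> preserves the measure.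
\<close>

lemma maximal_ergodic:
  assumes M: "finite_measure M" and T: "measure_preserving_map M T"
    and [measurable]: "f \<in> borel_measurable M" and B: "\<And>x. \<bar>f x\<bar> \<le> B"
  shows "0 \<le> (\<integral>x. f x * indicator {x. 0 < max_partial_sum T f n x} x \<partial>M)"
proof -
  interpret finite_measure M by fact
  have [measurable]: "T \<in> M \<rightarrow>\<^sub>M M" and D: "distr M M T = M"
    using T by (auto simp: measure_preserving_map_def)
  let ?R = "max_partial_sum T f n"
  have [measurable]: "?R \<in> borel_measurable M" by (rule max_partial_sum_measurable) auto
  have bd: "\<bar>?R x\<bar> \<le> real n * B" for x
    using max_partial_sum_le[where f=f and B=B, OF B, where x=x] max_partial_sum_nonneg[of T f n x] by auto
  have int: "integrable M ?R" "integrable M (\<lambda>x. ?R (T x))"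
    using bd by (auto intro!: integrable_const_bound[where B="real n * B"])
  have "0 = (\<integral>x. ?R x \<partial>M) - (\<integral>x. ?R x \<partial>(distr M M T))" by (simp add: D)
  also have "\<dots> = (\<integral>x. ?R x - ?R (T x) \<partial>M)" using int by (simp add: integral_distr)
  also have "\<dots> \<le> (\<integral>x. f x * indicator {x. 0 < ?R x} x \<partial>M)"
  proof (rule integral_mono)
    have "{x \<in> space M. 0 < ?R x} \<in> sets M" by measurable
    then have [measurable]: "(\<lambda>x. indicator {x. 0 < ?R x} x :: real) \<in> borel_measurable M"
      by (subst borel_measurable_indicator_iff) (simp add: Int_def conj_commute)
    show "integrable M (\<lambda>x. f x * indicator {x. 0 < ?R x} x)"
      using B order_trans[OF abs_ge_zero B]
      by (auto intro!: integrable_const_bound[where B=B] simp: abs_mult split: split_indicator)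
    show "?R x - ?R (T x) \<le> f x * indicator {x. 0 < ?R x} x" for x
    proof (cases "0 < ?R x")
      case True
      then obtain k where k: "n = Suc k" by (cases n) auto
      show ?thesis using True max_partial_sum_mono[of T f k "T x"] unfolding k by auto
    next
      case False
      then show ?thesis using max_partial_sum_nonneg[of T f n "T x"] by simp
    qed
  qed (use int in auto)
  finally show ?thesis .
qed

text \<open>
  For partial sums \<open>S\<close> this says \<open>limsup S n / n \<le> c\<close>, in a form whose measurability and shift
  invariance are elementary.
\<close>

definition asymptotically_below :: "real \<Rightarrow> (nat \<Rightarrow> real) \<Rightarrow> bool" where
  "asymptotically_below c S \<longleftrightarrow> (\<forall>k. \<exists>N. \<forall>n\<ge>N. S n \<le> (c + 1 / real (Suc k)) * real n)"

lemma asymptotically_below_transfer: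
  assumes S: "asymptotically_below c S" and S': "\<And>n. n \<ge> 1 \<Longrightarrow> S' n \<le> S (h n) + D"
    and h: "\<And>n. n \<ge> 1 \<Longrightarrow> n \<le> h n + 1 \<and> h n \<le> n + 1"
  shows "asymptotically_below c S'"
  unfolding asymptotically_below_def
proof
  fix k
  obtain N where N: "\<And>n. n \<ge> N \<Longrightarrow> S n \<le> (c + 1 / real (Suc (Suc k))) * real n"
    using S unfolding asymptotically_below_def by blast
  define e where "e = 1 / real (Suc (Suc k))"
  let ?c = "c + e" and ?d = "1 / real (Suc k) - e"
  have d: "?d > 0" using frac_less2[of 1 1 "real (Suc k)" "real (Suc (Suc k))"] by (simp add: e_def)
  obtain N' where N': "real N' \<ge> (\<bar>?c\<bar> + D) / ?d" using real_arch_simple by blast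
  show "\<exists>N. \<forall>n\<ge>N. S' n \<le> (c + 1 / real (Suc k)) * real n"
  proof (intro exI[of _ "max (Suc N) N' + 1"] allI impI)
    fix n assume n: "max (Suc N) N' + 1 \<le> n"
    then have "S' n \<le> S (h n) + D" using S' by auto
    also have "S (h n) \<le> ?c * real (h n)" using h[of n] n by (unfold e_def, intro N) auto
    also have "?c * real (h n) = ?c * real n + ?c * (real (h n) - real n)" by (simp add: algebra_simps)
    also have "?c * (real (h n) - real n) \<le> \<bar>?c\<bar> * 1"
    proof -
      have "\<bar>real (h n) - real n\<bar> \<le> 1" using h[of n] n by linarith
      then have "\<bar>?c * (real (h n) - real n)\<bar> \<le> \<bar>?c\<bar> * 1"
        unfolding abs_mult by (intro mult_left_mono) auto
      then show ?thesis by linarith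
    qed
    finally have *: "S' n \<le> ?c * real n + \<bar>?c\<bar> + D" by simp
    have "(\<bar>?c\<bar> + D) / ?d \<le> real n" using N' n by linarith
    then have "\<bar>?c\<bar> + D \<le> ?d * real n" using d by (simp add: pos_divide_le_eq mult.commute)
    with * have "S' n \<le> ?c * real n + ?d * real n" by linarith
    also have "\<dots> = (c + 1 / real (Suc k)) * real n" by (simp add: ring_distribs)
    finally show "S' n \<le> (c + 1 / real (Suc k)) * real n" .
  qed
qed

text \<open>
  The set where the bound holds is strictly invariant, so it has probability 0 or 1. Probability 0
  would make some partial sum of \<open>f - c\<close> positive almost everywhere; the maximal inequality in the
  limit \<open>n \<rightarrow> \<infinity>\<close> would then give \<open>\<integral>f \<ge> c\<close>.
\<close>

lemma ergodic_upper:
  assumes M: "prob_space M" and T: "ergodic_map M T"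
    and [measurable]: "f \<in> borel_measurable M" and B: "\<And>x. \<bar>f x\<bar> \<le> B"
    and c: "(\<integral>x. f x \<partial>M) < c"
  shows "AE x in M. asymptotically_below c (\<lambda>n. \<Sum>i<n. f ((T ^^ i) x))"
proof -
  interpret prob_space M by fact
  have mp: "measure_preserving_map M T" using T by (simp add: ergodic_map_def)
  have T_m[measurable]: "T \<in> M \<rightarrow>\<^sub>M M" using mp by (simp add: measure_preserving_map_def)
  have [measurable]: "(\<lambda>x. f ((T ^^ i) x)) \<in> borel_measurable M" for i
    using measurable_compose_n[OF T_m, of i] by measurable
  let ?S = "\<lambda>x n. \<Sum>i<n. f ((T ^^ i) x)"
  define A where "A = {x \<in> space M. asymptotically_below c (?S x)}"
  have A[measurable]: "A \<in> sets M" unfolding A_def asymptotically_below_def by measurable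
  have shift1: "asymptotically_below c (?S (T x))" if "asymptotically_below c (?S x)" for x
  proof (rule asymptotically_below_transfer[OF that, where h=Suc and D=B])
    show "?S (T x) n \<le> ?S x (Suc n) + B" for n
      unfolding birkhoff_sum_Suc using B[of x] by auto
  qed auto
  have shift2: "asymptotically_below c (?S x)" if "asymptotically_below c (?S (T x))" for x
  proof (rule asymptotically_below_transfer[OF that, where h="\<lambda>n. n - 1" and D=B])
    fix n :: nat assume "n \<ge> 1"
    then obtain k where k: "n = Suc k" by (cases n) auto
    show "?S x n \<le> ?S (T x) (n - 1) + B"
      unfolding k birkhoff_sum_Suc using B[of x] by auto
  qed auto
  have "T -` A \<inter> space M = A"
  proof (intro set_eqI iffI)
    fix x assume "x \<in> T -` A \<inter> space M" then show "x \<in> A"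
      using shift2[of x] unfolding A_def by blast
  next
    fix x assume "x \<in> A" then show "x \<in> T -` A \<inter> space M"
      using shift1[of x] measurable_space[OF T_m, of x] unfolding A_def by blast
  qed
  moreover have "\<forall>A\<in>sets M. T -` A \<inter> space M = A \<longrightarrow> prob A = 0 \<or> prob A = 1"
    using T unfolding ergodic_map_def by (rule conjunct2)
  ultimately have "prob A = 0 \<or> prob A = 1" using A by simp
  moreover have "prob A \<noteq> 0"
  proof
    assume 0: "prob A = 0"
    then have "A \<in> null_sets M" using A by (auto simp: emeasure_eq_measure)
    then have nA: "AE x in M. x \<notin> A" by (rule AE_not_in)
    let ?f = "\<lambda>x. f x - c"
    have B': "\<bar>?f x\<bar> \<le> B + \<bar>c\<bar>" for x using B[of x] by linarith
    let ?R = "max_partial_sum T ?f"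
    let ?I = "\<lambda>n x. indicator {x. 0 < ?R n x} x :: real"
    have lim: "AE x in M. (\<lambda>n. ?f x * ?I n x) \<longlonglongrightarrow> ?f x"
      using nA AE_space
    proof eventually_elim
      case (elim x)
      then obtain k where "\<forall>N. \<exists>n\<ge>N. ?S x n > (c + 1 / real (Suc k)) * real n"
        unfolding A_def asymptotically_below_def by (auto simp: not_le)
      then obtain n where n: "n \<ge> 1" "?S x n > (c + 1 / real (Suc k)) * real n" by blast
      have "(c + 1 / real (Suc k)) * real n > c * real n" using n(1) by (simp add: algebra_simps)
      then have "0 < (\<Sum>i<n. ?f ((T ^^ i) x))" using n(2) by (simp add: sum_subtractf mult.commute)
      also have "\<dots> \<le> ?R n x" by (rule birkhoff_sum_le_max)
      finally have pos: "0 < ?R n x" .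
      have "?I k x = 1" if "k \<ge> n" for k
        using that
      proof (induction k rule: dec_induct)
        case base then show ?case using pos by simp
      next
        case (step k)
        then have "0 < ?R k x" by (simp split: split_indicator_asm)
        then show ?case using max_partial_sum_mono[of T ?f k x] by simp
      qed
      then have "\<forall>\<^sub>F k in sequentially. ?f x * ?I k x = ?f x"
        unfolding eventually_sequentially by auto
      then show ?case by (rule tendsto_eventually)
    qed
    have [measurable]: "?I n \<in> borel_measurable M" for n
    proof -
      have [measurable]: "?R n \<in> borel_measurable M" by (rule max_partial_sum_measurable) auto
      have "{x \<in> space M. 0 < ?R n x} \<in> sets M" by measurable
      then show ?thesis
        by (subst borel_measurable_indicator_iff) (simp add: Int_def conj_commute)
    qed
    have "(\<lambda>n. \<integral>x. ?f x * ?I n x \<partial>M) \<longlonglongrightarrow> (\<integral>x. ?f x \<partial>M)"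
    proof (rule integral_dominated_convergence[where w="\<lambda>_. B + \<bar>c\<bar>", OF _ _ _ lim])
      show "AE x in M. norm (?f x * ?I n x) \<le> B + \<bar>c\<bar>" for n
        using B' order_trans[OF abs_ge_zero B'] by (auto simp: abs_mult split: split_indicator)
    qed auto
    then have "0 \<le> (\<integral>x. ?f x \<partial>M)"
      by (rule LIMSEQ_le_const)
         (use maximal_ergodic[OF finite_measure_axioms mp, of ?f "B + \<bar>c\<bar>"] B' in auto)
    moreover have "integrable M f" using B by (auto intro!: integrable_const_bound[where B=B])
    ultimately have "c \<le> (\<integral>x. f x \<partial>M)" by (simp add: prob_space)
    with c show False by simp
  qed
  ultimately have "prob A = 1" by blast
  then have "AE x in M. x \<in> A" using A prob_eq_1 by blast
  then show ?thesis by eventually_elim (simp add: A_def)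
qed

theorem birkhoff_ergodic:
  assumes M: "prob_space M" and T: "ergodic_map M T"
    and f[measurable]: "f \<in> borel_measurable M" and B: "\<And>x. \<bar>f x\<bar> \<le> B"
  shows "AE x in M. (\<lambda>n. (\<Sum>i<n. f ((T ^^ i) x)) / real n) \<longlonglongrightarrow> (\<integral>x. f x \<partial>M)"
proof -
  let ?m = "\<integral>x. f x \<partial>M"
  let ?S = "\<lambda>x n. \<Sum>i<n. f ((T ^^ i) x)"
  have up: "AE x in M. \<forall>k. asymptotically_below (?m + 1 / real (Suc k)) (?S x)"
    unfolding AE_all_countable
  proof
    fix k show "AE x in M. asymptotically_below (?m + 1 / real (Suc k)) (?S x)"
      by (rule ergodic_upper[OF M T f B]) simp
  qed
  have dn: "AE x in M. \<forall>k. asymptotically_below (- ?m + 1 / real (Suc k)) (\<lambda>n. - ?S x n)"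
    unfolding AE_all_countable
  proof
    fix k
    have *: "AE x in M. asymptotically_below (- ?m + 1 / real (Suc k)) (\<lambda>n. \<Sum>i<n. - f ((T ^^ i) x))"
      by (rule ergodic_upper[OF M T, where B=B]) (use B in auto)
    show "AE x in M. asymptotically_below (- ?m + 1 / real (Suc k)) (\<lambda>n. - ?S x n)"
      using * by (simp add: sum_negf)
  qed
  have bound: "\<forall>\<^sub>F n in sequentially. S n / real n < c + e"
    if S: "\<forall>k. asymptotically_below (c + 1 / real (Suc k)) S" and e: "e > 0" for S c e
  proof -
    obtain k where k: "1 / real (Suc k) < e / 2" using nat_approx_posE[of "e/2"] e by auto
    obtain N where N: "\<And>n. n \<ge> N \<Longrightarrow> S n \<le> (c + 1 / real (Suc k) + 1 / real (Suc k)) * real n"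
      using S unfolding asymptotically_below_def by meson
    have "S n / real n < c + e" if n: "n \<ge> max N 1" for n
    proof -
      have "S n \<le> (c + 1 / real (Suc k) + 1 / real (Suc k)) * real n" using N n by auto
      then have "S n / real n \<le> c + 1 / real (Suc k) + 1 / real (Suc k)"
        using n by (simp add: pos_divide_le_eq)
      then show ?thesis using k by linarith
    qed
    then show ?thesis unfolding eventually_sequentially by blast
  qed
  from up dn show ?thesis
  proof eventually_elim
    case (elim x)
    show ?case
    proof (rule order_tendstoI)
      fix a assume "a < ?m"
      then have "\<forall>\<^sub>F n in sequentially. - ?S x n / real n < - ?m + (?m - a)"
        by (intro bound[OF elim(2)]) simp
      then show "\<forall>\<^sub>F n in sequentially. a < ?S x n / real n"
        by eventually_elim simp
    next
      fix a assume "?m < a"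
      then have "\<forall>\<^sub>F n in sequentially. ?S x n / real n < ?m + (a - ?m)"
        by (intro bound[OF elim(1)]) simp
      then show "\<forall>\<^sub>F n in sequentially. ?S x n / real n < a" by simp
    qed
  qed
qed

section \<open>Burke's property for three exponential variables\<close>

abbreviation "exp_law \<equiv> exponential_distribution"

lemma nn_integral_exponential:
  assumes [measurable]: "F \<in> borel_measurable borel"
  shows "(\<integral>\<^sup>+x. F x \<partial>exp_law p) = (\<integral>\<^sup>+x. ennreal (exponential_density p x) * F x \<partial>lborel)"
  unfolding exponential_distribution_def by (subst nn_integral_density) auto

lemma nn_integral_exponential_scale:
  assumes [measurable]: "F \<in> borel_measurable borel" and p: "p > 0"
  shows "(\<integral>\<^sup>+x. F (x / p) \<partial>exp_law 1) = (\<integral>\<^sup>+x. F x \<partial>exp_law p)"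
proof -
  have "(\<integral>\<^sup>+x. F (x / p) \<partial>exp_law 1)
      = ennreal p * (\<integral>\<^sup>+x. ennreal (exponential_density 1 (p * x)) * F x \<partial>lborel)"
    using p by (subst nn_integral_exponential, simp, subst nn_integral_real_affine[of _ p 0]) auto
  also have "\<dots> = (\<integral>\<^sup>+x. ennreal p * ennreal (exponential_density 1 (p * x)) * F x \<partial>lborel)"
    by (subst nn_integral_cmult[symmetric]) (auto simp: mult.assoc)
  also have "\<dots> = (\<integral>\<^sup>+x. ennreal (exponential_density p x) * F x \<partial>lborel)"
    using p by (intro nn_integral_cong)
      (auto simp: ennreal_mult[symmetric] exponential_density_def mult_less_0_iff mult.commute)
  finally show ?thesis by (simp add: nn_integral_exponential)
qed

text \<open>
  On the part where \<open>u = x - y\<close> lies in \<open>S\<close>, the substitution \<open>x = y + u\<close> turns the joint density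
  of the three exponentials into a function of \<open>u\<close> and \<open>y + w\<close> alone.
\<close>

lemma exponential_triple_ordered:
  assumes p: "p > 0" and q: "q > 0" and S: "S \<in> sets borel" "S \<subseteq> {0..}"
    and [measurable]: "G \<in> borel_measurable (borel \<Otimes>\<^sub>M borel \<Otimes>\<^sub>M borel)"
  shows "(\<integral>\<^sup>+x. \<integral>\<^sup>+y. \<integral>\<^sup>+w. indicator S (x - y) * G (x, y, w)
              \<partial>exp_law (p + q) \<partial>exp_law q \<partial>exp_law p)
    = (\<integral>\<^sup>+u. \<integral>\<^sup>+y. \<integral>\<^sup>+w. ennreal (p * q * (p + q) * exp (- p * u - (p + q) * (y + w)))
          * indicator {0..} y * indicator {0..} w * indicator S u * G (y + u, y, w)
              \<partial>lborel \<partial>lborel \<partial>lborel)"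
proof -
  let ?D = "\<lambda>r x. ennreal (exponential_density r x)"
  note S(1)[measurable]
  have "(\<integral>\<^sup>+x. \<integral>\<^sup>+y. \<integral>\<^sup>+w. indicator S (x - y) * G (x, y, w)
              \<partial>exp_law (p + q) \<partial>exp_law q \<partial>exp_law p)
    = (\<integral>\<^sup>+x. \<integral>\<^sup>+y. \<integral>\<^sup>+w. ?D p x * ?D q y * ?D (p + q) w * indicator S (x - y) * G (x, y, w)
              \<partial>lborel \<partial>lborel \<partial>lborel)"
    by (simp add: nn_integral_exponential nn_integral_cmult[symmetric] mult.assoc)
  also have "\<dots> = (\<integral>\<^sup>+y. \<integral>\<^sup>+x. \<integral>\<^sup>+w. ?D p x * ?D q y * ?D (p + q) w * indicator S (x - y) * G (x, y, w)
              \<partial>lborel \<partial>lborel \<partial>lborel)"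
    by (rule lborel_pair.Fubini'[symmetric]) measurable
  also have "\<dots> = (\<integral>\<^sup>+y. \<integral>\<^sup>+u. \<integral>\<^sup>+w. ?D p (y + u) * ?D q y * ?D (p + q) w * indicator S u * G (y + u, y, w)
              \<partial>lborel \<partial>lborel \<partial>lborel)"
  proof (rule nn_integral_cong)
    fix y :: real
    have "(\<lambda>x. \<integral>\<^sup>+w. ?D p x * ?D q y * ?D (p + q) w * indicator S (x - y) * G (x, y, w) \<partial>lborel)
        \<in> borel_measurable borel" by measurable
    from nn_integral_real_affine[OF this, of 1 y]
    show "(\<integral>\<^sup>+x. \<integral>\<^sup>+w. ?D p x * ?D q y * ?D (p + q) w * indicator S (x - y) * G (x, y, w) \<partial>lborel \<partial>lborel)
      = (\<integral>\<^sup>+u. \<integral>\<^sup>+w. ?D p (y + u) * ?D q y * ?D (p + q) w * indicator S u * G (y + u, y, w)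
              \<partial>lborel \<partial>lborel)"
      by simp
  qed
  also have "\<dots> = (\<integral>\<^sup>+u. \<integral>\<^sup>+y. \<integral>\<^sup>+w. ?D p (y + u) * ?D q y * ?D (p + q) w * indicator S u * G (y + u, y, w)
              \<partial>lborel \<partial>lborel \<partial>lborel)"
    by (rule lborel_pair.Fubini') measurable
  also have "\<dots> = (\<integral>\<^sup>+u. \<integral>\<^sup>+y. \<integral>\<^sup>+w. ennreal (p * q * (p + q) * exp (- p * u - (p + q) * (y + w)))
          * indicator {0..} y * indicator {0..} w * indicator S u * G (y + u, y, w)
              \<partial>lborel \<partial>lborel \<partial>lborel)"
  proof (intro nn_integral_cong)
    fix u y w :: real
    have "?D p (y + u) * ?D q y * ?D (p + q) w =
        ennreal (p * q * (p + q) * exp (- p * u - (p + q) * (y + w))) * indicator {0..} y * indicator {0..} w"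
      if "u \<ge> 0"
    proof (cases "y \<ge> 0 \<and> w \<ge> 0")
      case True
      have "exp (- p * u - (p + q) * (y + w)) = exp (- (y + u) * p) * exp (- y * q) * exp (- w * (p + q))"
        by (simp add: exp_add[symmetric] algebra_simps)
      then show ?thesis using True that p q
        by (simp add: exponential_density_def ennreal_mult[symmetric] ac_simps)
    qed (auto simp: exponential_density_def)
    then show "?D p (y + u) * ?D q y * ?D (p + q) w * indicator S u * G (y + u, y, w)
      = ennreal (p * q * (p + q) * exp (- p * u - (p + q) * (y + w)))
          * indicator {0..} y * indicator {0..} w * indicator S u * G (y + u, y, w)"
      using S(2) by (cases "u \<in> S") auto
  qed
  finally show ?thesis .
qed

text \<open>
  After the substitution the density is symmetric in \<open>y\<close> and \<open>w\<close>, so these two variables can be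
  exchanged.
\<close>

lemma exponential_triple_ordered_swap:
  assumes p: "p > 0" and q: "q > 0" and S: "S \<in> sets borel" "S \<subseteq> {0..}"
    and [measurable]: "F \<in> borel_measurable (borel \<Otimes>\<^sub>M borel \<Otimes>\<^sub>M borel)"
  shows "(\<integral>\<^sup>+x. \<integral>\<^sup>+y. \<integral>\<^sup>+w. indicator S (x - y) * F (w + (x - y), w, y)
              \<partial>exp_law (p + q) \<partial>exp_law q \<partial>exp_law p)
    = (\<integral>\<^sup>+x. \<integral>\<^sup>+y. \<integral>\<^sup>+w. indicator S (x - y) * F (x, y, w)
              \<partial>exp_law (p + q) \<partial>exp_law q \<partial>exp_law p)"
proof -
  note S(1)[measurable]
  let ?K = "\<lambda>u y w. ennreal (p * q * (p + q) * exp (- p * u - (p + q) * (y + w)))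
          * indicator {0..} y * indicator {0..} w * indicator S u"
  have "(\<integral>\<^sup>+x. \<integral>\<^sup>+y. \<integral>\<^sup>+w. indicator S (x - y) * F (w + (x - y), w, y)
              \<partial>exp_law (p + q) \<partial>exp_law q \<partial>exp_law p)
      = (\<integral>\<^sup>+u. \<integral>\<^sup>+y. \<integral>\<^sup>+w. ?K u y w * F (w + u, w, y) \<partial>lborel \<partial>lborel \<partial>lborel)"
    using exponential_triple_ordered[OF p q S, of "\<lambda>(x, y, w). F (w + (x - y), w, y)"] by simp
  also have "\<dots> = (\<integral>\<^sup>+u. \<integral>\<^sup>+w. \<integral>\<^sup>+y. ?K u y w * F (w + u, w, y) \<partial>lborel \<partial>lborel \<partial>lborel)"
    by (intro nn_integral_cong lborel_pair.Fubini') measurable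
  also have "\<dots> = (\<integral>\<^sup>+u. \<integral>\<^sup>+y. \<integral>\<^sup>+w. ?K u y w * F (y + u, y, w) \<partial>lborel \<partial>lborel \<partial>lborel)"
    by (intro nn_integral_cong) (simp add: ac_simps)
  also have "\<dots> = (\<integral>\<^sup>+x. \<integral>\<^sup>+y. \<integral>\<^sup>+w. indicator S (x - y) * F (x, y, w)
              \<partial>exp_law (p + q) \<partial>exp_law q \<partial>exp_law p)"
    by (rule exponential_triple_ordered[OF p q S, symmetric]) measurable
  finally show ?thesis .
qed

lemma sets_exp_law_cong [measurable_cong]: "sets (exp_law r) = sets borel" by simp

text \<open>
  If \<open>x\<close>, \<open>y\<close> are the increments of a last-passage function across the bottom and the left edge of a
  cell and \<open>w\<close> is the weight of its corner, then the first two new values are the increments across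
  the top and the right edge. On either side of the diagonal \<open>x = y\<close> the map is an exchange of the
  smaller increment with \<open>w\<close>, so it preserves the joint law.
\<close>

theorem burke_corner:
  assumes p: "p > 0" and q: "q > 0"
    and [measurable]: "F \<in> borel_measurable (borel \<Otimes>\<^sub>M borel \<Otimes>\<^sub>M borel)"
  shows "(\<integral>\<^sup>+x. \<integral>\<^sup>+y. \<integral>\<^sup>+w. F (w + max 0 (x - y), w + max 0 (y - x), min x y)
              \<partial>exp_law (p + q) \<partial>exp_law q \<partial>exp_law p)
    = (\<integral>\<^sup>+x. \<integral>\<^sup>+y. \<integral>\<^sup>+w. F (x, y, w) \<partial>exp_law (p + q) \<partial>exp_law q \<partial>exp_law p)"
proof -
  let ?P = "exp_law p" and ?Q = "exp_law q" and ?R = "exp_law (p + q)"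
  interpret P: prob_space ?P using p by (rule prob_space_exponential_distribution)
  interpret Q: prob_space ?Q using q by (rule prob_space_exponential_distribution)
  interpret R: prob_space ?R using p q by (intro prob_space_exponential_distribution) simp
  interpret PQ: pair_prob_space ?P ?Q ..
  have split: "(\<integral>\<^sup>+x. \<integral>\<^sup>+y. \<integral>\<^sup>+w. G (x, y, w) \<partial>?R \<partial>?Q \<partial>?P)
      = (\<integral>\<^sup>+x. \<integral>\<^sup>+y. \<integral>\<^sup>+w. indicator {0<..} (x - y) * G (x, y, w) \<partial>?R \<partial>?Q \<partial>?P)
      + (\<integral>\<^sup>+y. \<integral>\<^sup>+x. \<integral>\<^sup>+w. indicator {0..} (y - x) * G (x, y, w) \<partial>?R \<partial>?P \<partial>?Q)"
    if [measurable]: "G \<in> borel_measurable (borel \<Otimes>\<^sub>M borel \<Otimes>\<^sub>M borel)" for G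
  proof -
    have "(\<integral>\<^sup>+x. \<integral>\<^sup>+y. \<integral>\<^sup>+w. G (x, y, w) \<partial>?R \<partial>?Q \<partial>?P)
      = (\<integral>\<^sup>+x. \<integral>\<^sup>+y. \<integral>\<^sup>+w. (indicator {0<..} (x - y) * G (x, y, w) + indicator {0..} (y - x) * G (x, y, w)) \<partial>?R \<partial>?Q \<partial>?P)"
      by (intro nn_integral_cong) (auto split: split_indicator)
    also have "\<dots> = (\<integral>\<^sup>+x. \<integral>\<^sup>+y. \<integral>\<^sup>+w. indicator {0<..} (x - y) * G (x, y, w) \<partial>?R \<partial>?Q \<partial>?P)
      + (\<integral>\<^sup>+x. \<integral>\<^sup>+y. \<integral>\<^sup>+w. indicator {0..} (y - x) * G (x, y, w) \<partial>?R \<partial>?Q \<partial>?P)"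
    proof -
      let ?A = "\<lambda>x y w. indicator {0<..} (x - y) * G (x, y, w)"
      let ?B = "\<lambda>x y w. indicator {0..} (y - x) * G (x, y, w)"
      have 1: "(\<integral>\<^sup>+w. ?A x y w + ?B x y w \<partial>?R) = (\<integral>\<^sup>+w. ?A x y w \<partial>?R) + (\<integral>\<^sup>+w. ?B x y w \<partial>?R)" for x y
        by (rule nn_integral_add) measurable
      have 2: "(\<integral>\<^sup>+y. (\<integral>\<^sup>+w. ?A x y w \<partial>?R) + (\<integral>\<^sup>+w. ?B x y w \<partial>?R) \<partial>?Q)
          = (\<integral>\<^sup>+y. \<integral>\<^sup>+w. ?A x y w \<partial>?R \<partial>?Q) + (\<integral>\<^sup>+y. \<integral>\<^sup>+w. ?B x y w \<partial>?R \<partial>?Q)" for x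
        by (rule nn_integral_add) measurable
      show ?thesis unfolding 1 2 by (rule nn_integral_add) measurable
    qed
    also have "(\<integral>\<^sup>+x. \<integral>\<^sup>+y. \<integral>\<^sup>+w. indicator {0..} (y - x) * G (x, y, w) \<partial>?R \<partial>?Q \<partial>?P)
        = (\<integral>\<^sup>+y. \<integral>\<^sup>+x. \<integral>\<^sup>+w. indicator {0..} (y - x) * G (x, y, w) \<partial>?R \<partial>?P \<partial>?Q)"
      by (rule PQ.Fubini'[symmetric]) measurable
    finally show ?thesis .
  qed
  let ?F = "\<lambda>(x, y, w). F (w + max 0 (x - y), w + max 0 (y - x), min x y)"
  have "(\<integral>\<^sup>+x. \<integral>\<^sup>+y. \<integral>\<^sup>+w. ?F (x, y, w) \<partial>?R \<partial>?Q \<partial>?P)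
      = (\<integral>\<^sup>+x. \<integral>\<^sup>+y. \<integral>\<^sup>+w. indicator {0<..} (x - y) * F (w + (x - y), w, y) \<partial>?R \<partial>?Q \<partial>?P)
      + (\<integral>\<^sup>+y. \<integral>\<^sup>+x. \<integral>\<^sup>+w. indicator {0..} (y - x) * F (w, w + (y - x), x) \<partial>?R \<partial>?P \<partial>?Q)"
    by (subst split, measurable)
       (intro arg_cong2[where f="(+)"] nn_integral_cong; auto split: split_indicator simp: max_def min_def)
  also have "(\<integral>\<^sup>+x. \<integral>\<^sup>+y. \<integral>\<^sup>+w. indicator {0<..} (x - y) * F (w + (x - y), w, y) \<partial>?R \<partial>?Q \<partial>?P)
      = (\<integral>\<^sup>+x. \<integral>\<^sup>+y. \<integral>\<^sup>+w. indicator {0<..} (x - y) * F (x, y, w) \<partial>?R \<partial>?Q \<partial>?P)"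
    by (rule exponential_triple_ordered_swap[OF p q]) auto
  also have "(\<integral>\<^sup>+y. \<integral>\<^sup>+x. \<integral>\<^sup>+w. indicator {0..} (y - x) * F (w, w + (y - x), x) \<partial>?R \<partial>?P \<partial>?Q)
      = (\<integral>\<^sup>+y. \<integral>\<^sup>+x. \<integral>\<^sup>+w. indicator {0..} (y - x) * F (x, y, w) \<partial>?R \<partial>?P \<partial>?Q)"
    using exponential_triple_ordered_swap[OF q p, of "{0..}" "\<lambda>(y, x, w). F (x, y, w)"]
    by (simp add: add.commute)
  also have "(\<integral>\<^sup>+x. \<integral>\<^sup>+y. \<integral>\<^sup>+w. indicator {0<..} (x - y) * F (x, y, w) \<partial>?R \<partial>?Q \<partial>?P)
      + (\<integral>\<^sup>+y. \<integral>\<^sup>+x. \<integral>\<^sup>+w. indicator {0..} (y - x) * F (x, y, w) \<partial>?R \<partial>?P \<partial>?Q)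
      = (\<integral>\<^sup>+x. \<integral>\<^sup>+y. \<integral>\<^sup>+w. F (x, y, w) \<partial>?R \<partial>?Q \<partial>?P)"
    by (rule split[symmetric]) measurable
  finally show ?thesis by simp
qed

text \<open>
  All rates are moved from the laws into the map, so that models with different rates can later be
  built on the same field of unit exponentials.
\<close>

corollary burke_corner_unit:
  assumes p: "p > 0" and q: "q > 0"
    and [measurable]: "F \<in> borel_measurable (borel \<Otimes>\<^sub>M borel \<Otimes>\<^sub>M borel)"
  shows "(\<integral>\<^sup>+x. \<integral>\<^sup>+y. \<integral>\<^sup>+w. F (p * (w / (p + q) + max 0 (x / p - y / q)),
              q * (w / (p + q) + max 0 (y / q - x / p)), (p + q) * min (x / p) (y / q))
              \<partial>exp_law 1 \<partial>exp_law 1 \<partial>exp_law 1)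
    = (\<integral>\<^sup>+x. \<integral>\<^sup>+y. \<integral>\<^sup>+w. F (x, y, w) \<partial>exp_law 1 \<partial>exp_law 1 \<partial>exp_law 1)"
proof -
  interpret P: prob_space "exp_law p" using p by (rule prob_space_exponential_distribution)
  interpret Q: prob_space "exp_law q" using q by (rule prob_space_exponential_distribution)
  interpret R: prob_space "exp_law (p + q)" using p q by (intro prob_space_exponential_distribution) simp
  interpret E: prob_space "exp_law 1" by (rule prob_space_exponential_distribution) simp
  have r: "p + q > 0" using p q by simp
  have scale: "(\<integral>\<^sup>+x. \<integral>\<^sup>+y. \<integral>\<^sup>+w. G (x / p, y / q, w / (p + q)) \<partial>exp_law 1 \<partial>exp_law 1 \<partial>exp_law 1)
     = (\<integral>\<^sup>+x. \<integral>\<^sup>+y. \<integral>\<^sup>+w. G (x, y, w) \<partial>exp_law (p + q) \<partial>exp_law q \<partial>exp_law p)"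
    if [measurable]: "G \<in> borel_measurable (borel \<Otimes>\<^sub>M borel \<Otimes>\<^sub>M borel)" for G
  proof -
    have 1: "(\<integral>\<^sup>+w. G (x, y, w / (p + q)) \<partial>exp_law 1) = (\<integral>\<^sup>+w. G (x, y, w) \<partial>exp_law (p + q))" for x y
      by (rule nn_integral_exponential_scale[OF _ r]) measurable
    have 2: "(\<integral>\<^sup>+y. \<integral>\<^sup>+w. G (x, y / q, w) \<partial>exp_law (p + q) \<partial>exp_law 1)
        = (\<integral>\<^sup>+y. \<integral>\<^sup>+w. G (x, y, w) \<partial>exp_law (p + q) \<partial>exp_law q)" for x
      by (rule nn_integral_exponential_scale[OF _ q]) measurable
    have 3: "(\<integral>\<^sup>+x. \<integral>\<^sup>+y. \<integral>\<^sup>+w. G (x / p, y, w) \<partial>exp_law (p + q) \<partial>exp_law q \<partial>exp_law 1)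
        = (\<integral>\<^sup>+x. \<integral>\<^sup>+y. \<integral>\<^sup>+w. G (x, y, w) \<partial>exp_law (p + q) \<partial>exp_law q \<partial>exp_law p)"
      by (rule nn_integral_exponential_scale[OF _ p]) measurable
    show ?thesis by (simp add: 1 2 3)
  qed
  let ?G = "\<lambda>(x, y, w). F (p * x, q * y, (p + q) * w)"
  let ?H = "\<lambda>(x, y, w). ?G (w + max 0 (x - y), w + max 0 (y - x), min x y)"
  have "(\<integral>\<^sup>+x. \<integral>\<^sup>+y. \<integral>\<^sup>+w. ?H (x / p, y / q, w / (p + q)) \<partial>exp_law 1 \<partial>exp_law 1 \<partial>exp_law 1)
    = (\<integral>\<^sup>+x. \<integral>\<^sup>+y. \<integral>\<^sup>+w. ?H (x, y, w) \<partial>exp_law (p + q) \<partial>exp_law q \<partial>exp_law p)"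
    by (rule scale) measurable
  also have "\<dots> = (\<integral>\<^sup>+x. \<integral>\<^sup>+y. \<integral>\<^sup>+w. ?G (x, y, w) \<partial>exp_law (p + q) \<partial>exp_law q \<partial>exp_law p)"
    using burke_corner[OF p q, of ?G] by simp
  also have "\<dots> = (\<integral>\<^sup>+x. \<integral>\<^sup>+y. \<integral>\<^sup>+w. ?G (x / p, y / q, w / (p + q)) \<partial>exp_law 1 \<partial>exp_law 1 \<partial>exp_law 1)"
    by (rule scale[symmetric]) measurable
  finally show ?thesis using p q r by simp
qed

section \<open>Measure-preserving corner flips\<close>

abbreviation seed_law :: "('i \<Rightarrow> real) measure" where
  "seed_law \<equiv> PiM UNIV (\<lambda>_. exp_law 1)"

lemma prob_space_exp_law_1: "prob_space (exp_law 1)"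
  by (rule prob_space_exponential_distribution) simp

lemma prob_space_seed_law: "prob_space seed_law"
  by (rule prob_space_PiM) (rule prob_space_exp_law_1)

text \<open>
  Resampling one coordinate does not change the law. Applied to three coordinates it reduces a
  statement about the whole field to one about three exponentials, without any decomposition of the
  index set.
\<close>

lemma nn_integral_seed_resample:
  fixes F :: "('i \<Rightarrow> real) \<Rightarrow> ennreal"
  assumes [measurable]: "F \<in> borel_measurable seed_law"
  shows "(\<integral>\<^sup>+X. F X \<partial>seed_law) = (\<integral>\<^sup>+X. \<integral>\<^sup>+x. F (X(i := x)) \<partial>exp_law 1 \<partial>seed_law)"
proof -
  interpret E: prob_space "exp_law 1" by (rule prob_space_exp_law_1)
  interpret P: prob_space "seed_law :: ('i \<Rightarrow> real) measure" by (rule prob_space_seed_law)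
  interpret EP: pair_prob_space "exp_law 1" "seed_law :: ('i \<Rightarrow> real) measure" ..
  have upd[measurable]: "(\<lambda>(x, X). X(i := x)) \<in> exp_law 1 \<Otimes>\<^sub>M seed_law \<rightarrow>\<^sub>M (seed_law :: ('i \<Rightarrow> real) measure)"
    unfolding case_prod_beta' by (rule measurable_fun_upd[where J=UNIV]) auto
  have D: "distr (exp_law 1 \<Otimes>\<^sub>M seed_law) seed_law (\<lambda>(x, X). X(i := x)) = (seed_law :: ('i \<Rightarrow> real) measure)"
    using distr_pair_PiM_eq_PiM[where I=UNIV and M="\<lambda>_. exp_law 1" and i'=i] prob_space_exp_law_1 by simp
  have "(\<integral>\<^sup>+X. F X \<partial>seed_law)
      = (\<integral>\<^sup>+X. F X \<partial>distr (exp_law 1 \<Otimes>\<^sub>M seed_law) seed_law (\<lambda>(x, X). X(i := x)))" by (simp only: D)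
  also have "\<dots> = (\<integral>\<^sup>+z. F (case z of (x, X) \<Rightarrow> X(i := x)) \<partial>(exp_law 1 \<Otimes>\<^sub>M seed_law))"
    by (rule nn_integral_distr) measurable
  also have "\<dots> = (\<integral>\<^sup>+X. \<integral>\<^sup>+x. F (X(i := x)) \<partial>exp_law 1 \<partial>seed_law)"
    by (subst EP.nn_integral_snd[symmetric]) auto
  finally show ?thesis .
qed

lemma nn_integral_seed_resample3:
  fixes F :: "('i \<Rightarrow> real) \<Rightarrow> ennreal"
  assumes [measurable]: "F \<in> borel_measurable seed_law"
  shows "(\<integral>\<^sup>+X. F X \<partial>seed_law) = (\<integral>\<^sup>+X. \<integral>\<^sup>+x. \<integral>\<^sup>+y. \<integral>\<^sup>+w. F (X(i := x, j := y, k := w))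
            \<partial>exp_law 1 \<partial>exp_law 1 \<partial>exp_law 1 \<partial>seed_law)"
proof -
  interpret E: prob_space "exp_law 1" by (rule prob_space_exp_law_1)
  have [measurable]: "(\<lambda>(X, x). X(l := x)) \<in> seed_law \<Otimes>\<^sub>M exp_law 1 \<rightarrow>\<^sub>M (seed_law :: ('i \<Rightarrow> real) measure)" for l
    unfolding case_prod_beta' by (rule measurable_fun_upd[where J=UNIV]) auto
  have upd[measurable]: "(\<lambda>z. (f z)(l := g z)) \<in> N \<rightarrow>\<^sub>M (seed_law :: ('i \<Rightarrow> real) measure)"
    if "f \<in> N \<rightarrow>\<^sub>M seed_law" "g \<in> borel_measurable N" for N l and f :: "'z \<Rightarrow> 'i \<Rightarrow> real" and g
    using that by (intro measurable_fun_upd[where J=UNIV]) auto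
  have "(\<integral>\<^sup>+X. F X \<partial>seed_law) = (\<integral>\<^sup>+X. \<integral>\<^sup>+w. F (X(k := w)) \<partial>exp_law 1 \<partial>seed_law)"
    by (rule nn_integral_seed_resample) measurable
  also have "\<dots> = (\<integral>\<^sup>+X. \<integral>\<^sup>+y. \<integral>\<^sup>+w. F (X(j := y, k := w)) \<partial>exp_law 1 \<partial>exp_law 1 \<partial>seed_law)"
    by (rule nn_integral_seed_resample) measurable
  also have "\<dots> = (\<integral>\<^sup>+X. \<integral>\<^sup>+x. \<integral>\<^sup>+y. \<integral>\<^sup>+w. F (X(i := x, j := y, k := w))
            \<partial>exp_law 1 \<partial>exp_law 1 \<partial>exp_law 1 \<partial>seed_law)"
    by (rule nn_integral_seed_resample) measurable
  finally show ?thesis .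
qed

text \<open>
  The coordinates \<open>i\<close> and \<open>j\<close> carry, in units of their rates \<open>p\<close> and \<open>q\<close>, the increments that enter
  a cell and \<open>k\<close> carries its weight, of rate \<open>p + q\<close>; after the flip \<open>i\<close> and \<open>j\<close> carry the
  increments that leave it.
\<close>

definition corner_flip :: "real \<Rightarrow> real \<Rightarrow> 'i \<Rightarrow> 'i \<Rightarrow> 'i \<Rightarrow> ('i \<Rightarrow> real) \<Rightarrow> ('i \<Rightarrow> real)" where
  "corner_flip p q i j k X = X(
     i := p * (X k / (p + q) + max 0 (X i / p - X j / q)),
     j := q * (X k / (p + q) + max 0 (X j / q - X i / p)),
     k := (p + q) * min (X i / p) (X j / q))"

lemma corner_flip_measure_preserving:
  fixes i j k :: 'i
  assumes p: "p > 0" and q: "q > 0" and d: "i \<noteq> j" "i \<noteq> k" "j \<noteq> k"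
  shows "measure_preserving_map seed_law (corner_flip p q i j k)"
  unfolding measure_preserving_map_def
proof
  have comp: "(\<lambda>X. X l) \<in> borel_measurable (seed_law :: ('i \<Rightarrow> real) measure)" for l
    using measurable_component_singleton[of l UNIV "\<lambda>_. exp_law 1"] by (simp cong: measurable_cong_sets)
  note comp[measurable]
  interpret E: prob_space "exp_law 1" by (rule prob_space_exp_law_1)
  have upd: "(\<lambda>z. (f z)(l := g z)) \<in> N \<rightarrow>\<^sub>M (seed_law :: ('i \<Rightarrow> real) measure)"
    if "f \<in> N \<rightarrow>\<^sub>M seed_law" "g \<in> borel_measurable N" for N l and f :: "'z \<Rightarrow> 'i \<Rightarrow> real" and g
    using that by (intro measurable_fun_upd[where J=UNIV]) auto
  show T[measurable]: "corner_flip p q i j k \<in> seed_law \<rightarrow>\<^sub>M seed_law"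
    unfolding corner_flip_def by (intro upd) measurable
  show "distr seed_law seed_law (corner_flip p q i j k) = seed_law"
  proof (rule measure_eqI)
    fix A assume "A \<in> sets (distr seed_law seed_law (corner_flip p q i j k))"
    then have A[measurable]: "A \<in> sets (seed_law :: ('i \<Rightarrow> real) measure)" by simp
    let ?I = "\<lambda>X. indicator A X :: ennreal"
    have "emeasure (distr seed_law seed_law (corner_flip p q i j k)) A
        = (\<integral>\<^sup>+X. ?I (corner_flip p q i j k X) \<partial>seed_law)"
      by (subst nn_integral_indicator[symmetric], simp, subst nn_integral_distr) auto
    also have "\<dots> = (\<integral>\<^sup>+X. \<integral>\<^sup>+x. \<integral>\<^sup>+y. \<integral>\<^sup>+w. ?I (corner_flip p q i j k (X(i := x, j := y, k := w)))
            \<partial>exp_law 1 \<partial>exp_law 1 \<partial>exp_law 1 \<partial>seed_law)"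
      by (rule nn_integral_seed_resample3) measurable
    also have "\<dots> = (\<integral>\<^sup>+X. \<integral>\<^sup>+x. \<integral>\<^sup>+y. \<integral>\<^sup>+w. ?I (X(i := x, j := y, k := w))
            \<partial>exp_law 1 \<partial>exp_law 1 \<partial>exp_law 1 \<partial>seed_law)"
    proof (rule nn_integral_cong)
      fix X :: "'i \<Rightarrow> real" assume X: "X \<in> space seed_law"
      let ?F = "\<lambda>(x, y, w). ?I (X(i := x, j := y, k := w))"
      have "(\<lambda>z. X(i := fst z, j := fst (snd z), k := snd (snd z)))
          \<in> borel \<Otimes>\<^sub>M borel \<Otimes>\<^sub>M borel \<rightarrow>\<^sub>M seed_law"
        using X by (intro upd) auto
      then have F: "?F \<in> borel_measurable (borel \<Otimes>\<^sub>M borel \<Otimes>\<^sub>M borel)"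
        unfolding case_prod_beta' by measurable
      have "corner_flip p q i j k (X(i := x, j := y, k := w)) = X(
         i := p * (w / (p + q) + max 0 (x / p - y / q)),
         j := q * (w / (p + q) + max 0 (y / q - x / p)),
         k := (p + q) * min (x / p) (y / q))" for x y w
        using d by (auto simp: corner_flip_def fun_eq_iff)
      then show "(\<integral>\<^sup>+x. \<integral>\<^sup>+y. \<integral>\<^sup>+w. ?I (corner_flip p q i j k (X(i := x, j := y, k := w)))
            \<partial>exp_law 1 \<partial>exp_law 1 \<partial>exp_law 1)
         = (\<integral>\<^sup>+x. \<integral>\<^sup>+y. \<integral>\<^sup>+w. ?I (X(i := x, j := y, k := w)) \<partial>exp_law 1 \<partial>exp_law 1 \<partial>exp_law 1)"
        using burke_corner_unit[OF p q F] by simp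
    qed
    also have "\<dots> = (\<integral>\<^sup>+X. ?I X \<partial>seed_law)"
      by (rule nn_integral_seed_resample3[symmetric]) measurable
    also have "\<dots> = emeasure seed_law A" by simp
    finally show "emeasure (distr seed_law seed_law (corner_flip p q i j k)) A = emeasure seed_law A" .
  qed simp
qed

lemma measure_preserving_comp:
  assumes "measure_preserving_map M S" "measure_preserving_map M T"
  shows "measure_preserving_map M (S \<circ> T)"
  using assms distr_distr[of S M M T M] unfolding measure_preserving_map_def by auto

section \<open>Increments of last-passage times along a column\<close>

text \<open>
  Last-passage times from the origin over all of \<open>\<nat>\<^sup>2\<close>. The axes serve as a boundary whose weights
  can be chosen, and the weight of the origin is not counted.
\<close>

fun lpp :: "(nat \<times> nat \<Rightarrow> real) \<Rightarrow> nat \<Rightarrow> nat \<Rightarrow> real" where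
  "lpp w 0 0 = 0"
| "lpp w (Suc i) 0 = lpp w i 0 + w (Suc i, 0)"
| "lpp w 0 (Suc j) = lpp w 0 j + w (0, Suc j)"
| "lpp w (Suc i) (Suc j) = w (Suc i, Suc j) + max (lpp w i (Suc j)) (lpp w (Suc i) j)"

definition weights :: "(nat \<Rightarrow> real) \<Rightarrow> (nat \<Rightarrow> real) \<Rightarrow> (nat \<times> nat \<Rightarrow> real) \<Rightarrow> (nat \<times> nat \<Rightarrow> real)" where
  "weights a b X = (\<lambda>(i, j). X (i, j) / (a i + b j))"

text \<open>
  The axes are an additional row and column of the environment, with parameters \<open>a 0\<close> and \<open>b 0\<close>;
  the condition \<open>a 0 + b 0 = 0\<close> is what makes the rates of the two boundary sites facing \<open>(i, j)\<close> add
  up to \<open>a i + b j\<close>, as a corner flip requires. Flipping the cells one after the other, each column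
  from bottom to top, transports the increments from the vertical axis to column \<open>m\<close>, and every
  flip preserves the law of the field. In particular the increments along column \<open>m\<close> have the same
  joint law as those along the axis.
\<close>

theorem burke_column:
  assumes pos: "\<And>i j. (i, j) \<noteq> (0, 0) \<Longrightarrow> a i + b j > 0" and zero: "a 0 + b 0 = 0"
  shows "\<exists>T. measure_preserving_map seed_law T \<and> (\<forall>X.
     (\<forall>k<n. weights a b (T X) (0, Suc k) = lpp (weights a b X) m (Suc k) - lpp (weights a b X) m k)
     \<and> (\<forall>i j. m < i \<longrightarrow> T X (i, j) = X (i, j)))"
proof (induction m)
  case 0
  have "measure_preserving_map seed_law (\<lambda>X. X)"
    by (simp add: measure_preserving_map_def distr_id)
  then show ?case by (intro exI[of _ "\<lambda>X. X"]) auto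
next
  case (Suc m)
  let ?G = "\<lambda>X. lpp (weights a b X)"
  \<comment> \<open>State in the middle of column \<open>Suc m\<close>, when its first \<open>j\<close> cells have been flipped: the horizontal
    increment at height \<open>j\<close> is stored at \<open>(Suc m, 0)\<close>, and the vertical ones at \<open>(0, Suc k)\<close> belong to the
    new column for \<open>k < j\<close> and to the old one above.\<close>
  have step: "j \<le> n \<Longrightarrow> \<exists>T. measure_preserving_map seed_law T \<and> (\<forall>X.
      weights a b (T X) (Suc m, 0) = ?G X (Suc m) j - ?G X m j
      \<and> (\<forall>k<n. weights a b (T X) (0, Suc k) = (if k < j then ?G X (Suc m) (Suc k) - ?G X (Suc m) k
            else ?G X m (Suc k) - ?G X m k))
      \<and> (\<forall>k. j < k \<longrightarrow> T X (Suc m, k) = X (Suc m, k))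
      \<and> (\<forall>i k. Suc m < i \<longrightarrow> T X (i, k) = X (i, k)))" for j
  proof (induction j)
    case 0
    obtain T where T: "measure_preserving_map seed_law T"
      "\<And>X k. k < n \<Longrightarrow> weights a b (T X) (0, Suc k) = ?G X m (Suc k) - ?G X m k"
      "\<And>X i j. m < i \<Longrightarrow> T X (i, j) = X (i, j)" using Suc.IH by blast
    then show ?case by (intro exI[of _ T]) (auto simp: weights_def)
  next
    case (Suc j)
    then obtain T where T: "measure_preserving_map seed_law T"
      "\<And>X. weights a b (T X) (Suc m, 0) = ?G X (Suc m) j - ?G X m j"
      "\<And>X k. k < n \<Longrightarrow> weights a b (T X) (0, Suc k) = (if k < j then ?G X (Suc m) (Suc k) - ?G X (Suc m) k
            else ?G X m (Suc k) - ?G X m k)"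
      "\<And>X k. j < k \<Longrightarrow> T X (Suc m, k) = X (Suc m, k)"
      "\<And>X i k. Suc m < i \<Longrightarrow> T X (i, k) = X (i, k)" by (metis Suc_leD)
    define p q where "p = a (Suc m) + b 0" and "q = a 0 + b (Suc j)"
    have pq: "p > 0" "q > 0" and r: "p + q = a (Suc m) + b (Suc j)"
      using pos[of "Suc m" 0] pos[of 0 "Suc j"] zero by (auto simp: p_def q_def)
    let ?i = "(Suc m, 0::nat)" and ?j = "(0::nat, Suc j)" and ?k = "(Suc m, Suc j)"
    let ?f = "corner_flip p q ?i ?j ?k"
    have mp: "measure_preserving_map seed_law (?f \<circ> T)"
      by (intro measure_preserving_comp corner_flip_measure_preserving T pq) auto
    have I: "T X ?i / p = ?G X (Suc m) j - ?G X m j" for X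
      using T(2)[of X] by (simp add: weights_def p_def)
    have J: "T X ?j / q = ?G X m (Suc j) - ?G X m j" for X
      using T(3)[of j X] Suc.prems by (simp add: weights_def q_def)
    have W: "T X ?k / (p + q) = weights a b X ?k" for X
      using T(4)[of "Suc j" X] by (simp add: weights_def r)
    have pq0: "p \<noteq> 0" "q \<noteq> 0" using pq by auto
    have A: "weights a b ((?f \<circ> T) X) (Suc m, 0) = ?G X (Suc m) (Suc j) - ?G X m (Suc j)" for X
    proof -
      have "weights a b ((?f \<circ> T) X) (Suc m, 0) = T X ?k / (p + q) + max 0 (T X ?i / p - T X ?j / q)"
        using pq0 by (simp add: weights_def corner_flip_def flip: p_def)
      also have "\<dots> = ?G X (Suc m) (Suc j) - ?G X m (Suc j)"
        unfolding I J W by (auto simp: max_def)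
      finally show ?thesis .
    qed
    have B: "weights a b ((?f \<circ> T) X) (0, Suc k) = (if k < Suc j then ?G X (Suc m) (Suc k) - ?G X (Suc m) k
            else ?G X m (Suc k) - ?G X m k)" if "k < n" for X k
    proof (cases "k = j")
      case True
      have "weights a b ((?f \<circ> T) X) (0, Suc j) = T X ?k / (p + q) + max 0 (T X ?j / q - T X ?i / p)"
        using pq0 by (simp add: weights_def corner_flip_def flip: q_def)
      also have "\<dots> = ?G X (Suc m) (Suc j) - ?G X (Suc m) j"
        unfolding I J W by (auto simp: max_def)
      finally show ?thesis using True by simp
    next
      case False
      then have "weights a b ((?f \<circ> T) X) (0, Suc k) = weights a b (T X) (0, Suc k)"
        by (simp add: weights_def corner_flip_def)
      then show ?thesis using T(3)[OF that, of X] False by auto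
    qed
    have C: "(?f \<circ> T) X (Suc m, k) = X (Suc m, k)" if "Suc j < k" for X k
      using that T(4)[of k X] by (simp add: corner_flip_def)
    have D: "(?f \<circ> T) X (i, k) = X (i, k)" if "Suc m < i" for X i k
      using that T(5)[of i X k] by (simp add: corner_flip_def)
    show ?case
      by (rule exI[of _ "?f \<circ> T"]) (intro conjI allI impI mp A B C D)
  qed
  from step[of n] obtain T where "measure_preserving_map seed_law T"
      "\<And>X k. k < n \<Longrightarrow> weights a b (T X) (0, Suc k) = ?G X (Suc m) (Suc k) - ?G X (Suc m) k"
      "\<And>X i k. Suc m < i \<Longrightarrow> T X (i, k) = X (i, k)" by auto
  then show ?case by (intro exI[of _ T]) auto
qed

section \<open>Fluctuations of sums of independent exponentials\<close>

definition l2_null :: "'a measure \<Rightarrow> (nat \<Rightarrow> 'a \<Rightarrow> real) \<Rightarrow> bool" where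
  "l2_null M e \<longleftrightarrow> (\<forall>n. e n \<in> borel_measurable M \<and> integrable M (\<lambda>x. (e n x)\<^sup>2))
      \<and> (\<lambda>n. \<integral>x. (e n x)\<^sup>2 \<partial>M) \<longlonglongrightarrow> 0"

text \<open>
  Finitely many sequences that tend to zero in mean square can be made to converge almost surely
  along one common subsequence. As the shape function is an almost sure limit, a single sample point
  and a subsequence are enough to compute it.
\<close>

lemma l2_null_subseq:
  assumes K: "finite K" and e: "\<And>e. e \<in> K \<Longrightarrow> l2_null M e"
  shows "\<exists>r::nat \<Rightarrow> nat. strict_mono r \<and> (AE x in M. \<forall>e\<in>K. (\<lambda>n. e (r n) x) \<longlonglongrightarrow> 0)"
proof -
  let ?u = "\<lambda>n x. \<Sum>e\<in>K. (e n x)\<^sup>2"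
  have int: "integrable M (\<lambda>x. (e n x)\<^sup>2)" if "e \<in> K" for e n
    using e[OF that] by (simp add: l2_null_def)
  have "(\<lambda>n. \<Sum>e\<in>K. \<integral>x. (e n x)\<^sup>2 \<partial>M) \<longlonglongrightarrow> (\<Sum>e\<in>K. 0)"
    using e by (intro tendsto_sum) (simp add: l2_null_def)
  moreover have "(\<integral>x. norm (?u n x) \<partial>M) = (\<Sum>e\<in>K. \<integral>x. (e n x)\<^sup>2 \<partial>M)" for n
    using int by (subst Bochner_Integration.integral_sum[symmetric]) (auto simp: sum_nonneg)
  ultimately have "(\<lambda>n. \<integral>x. norm (?u n x) \<partial>M) \<longlonglongrightarrow> 0" by simp
  moreover have "integrable M (?u n)" for n using int by auto
  ultimately obtain r :: "nat \<Rightarrow> nat" where r: "strict_mono r" "AE x in M. (\<lambda>n. ?u (r n) x) \<longlonglongrightarrow> 0"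
    using tendsto_L1_AE_subseq[of M ?u] by auto
  have "AE x in M. \<forall>e\<in>K. (\<lambda>n. e (r n) x) \<longlonglongrightarrow> 0"
    using r(2)
  proof eventually_elim
    case (elim x)
    show ?case
    proof
      fix e assume k: "e \<in> K"
      have "(\<lambda>n. (e (r n) x)\<^sup>2) \<longlonglongrightarrow> 0"
      proof (rule tendsto_sandwich[OF _ _ tendsto_const elim])
        show "\<forall>\<^sub>F n in sequentially. (e (r n) x)\<^sup>2 \<le> ?u (r n) x"
          using K k by (intro always_eventually allI member_le_sum) auto
      qed auto
      then show "(\<lambda>n. e (r n) x) \<longlonglongrightarrow> 0"
        using tendsto_real_sqrt[of "\<lambda>n. (e (r n) x)\<^sup>2" 0] by (simp add: tendsto_rabs_zero_iff)
    qed
  qed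
  with r(1) show ?thesis by blast
qed

lemma measurable_seed_component [measurable]: "(\<lambda>X. X l) \<in> borel_measurable seed_law"
  using measurable_component_singleton[of l UNIV "\<lambda>_. exp_law 1"] by (simp cong: measurable_cong_sets)

lemma seed_component_distributed:
  "distributed seed_law lborel (\<lambda>X. X l) (exponential_density 1)"
proof -
  have "distr seed_law (exp_law 1) (\<lambda>X. X l) = exp_law 1"
    by (rule distr_PiM_component) (auto intro: prob_space_exp_law_1)
  then have "distr seed_law lborel (\<lambda>X. X l) = exp_law 1"
    by (metis distr_cong sets_exponential_distribution sets_lborel)
  then show ?thesis
    by (auto simp: distributed_def exponential_distribution_def exponential_density_def)
qed

lemma indep_seed: "prob_space.indep_vars seed_law (\<lambda>_. borel) (\<lambda>l X. X l) (UNIV :: 'i set)"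
proof -
  interpret prob_space "seed_law :: ('i \<Rightarrow> real) measure" by (rule prob_space_seed_law)
  have D: "distr seed_law borel (\<lambda>X. X l) = exp_law 1" for l :: 'i
    using distr_PiM_component[of UNIV "\<lambda>_. exp_law 1" l] prob_space_exp_law_1
    by (metis UNIV_I distr_cong sets_exponential_distribution)
  have S: "sets (seed_law :: ('i \<Rightarrow> real) measure) = sets (PiM UNIV (\<lambda>_. borel))"
    by (intro sets_PiM_cong) auto
  show ?thesis
    by (subst indep_vars_iff_distr_eq_PiM')
       (auto simp: D intro!: trans[OF distr_cong[OF refl S[symmetric]] distr_id])
qed

lemma seed_moments:
  fixes l l' :: 'i
  shows "integrable seed_law (\<lambda>X. (X l - 1) * (X l' - 1))"
  "(\<integral>X. (X l - 1) * (X l' - 1) \<partial>seed_law) = (if l = l' then 1 else 0)"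
proof -
  interpret prob_space "seed_law :: ('i \<Rightarrow> real) measure" by (rule prob_space_seed_law)
  note D = seed_component_distributed
  have m1: "integrable seed_law (\<lambda>X. X k)" "expectation (\<lambda>X. X k) = 1" for k :: 'i
    using erlang_ith_moment_integrable[OF _ D, of k 1] exponential_distributed_expectation[OF _ D, of k] by auto
  have m2: "integrable seed_law (\<lambda>X. (X k - 1)\<^sup>2)" for k :: 'i
    using erlang_ith_moment_integrable[OF _ D, of k 2] m1[of k] by (simp add: power2_diff)
  have "integrable seed_law (\<lambda>X. (X l - 1) * (X l' - 1))
    \<and> (\<integral>X. (X l - 1) * (X l' - 1) \<partial>seed_law) = (if l = l' then 1 else 0)"
  proof (cases "l = l'")
    case True
    then show ?thesis
      using m2[of l] exponential_distributed_variance[OF _ D, of l] m1(2)[of l] by (simp add: power2_eq_square)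
  next
    case False
    have "indep_vars (\<lambda>_. borel) (\<lambda>k X. X k - 1) (UNIV :: 'i set)"
      by (rule indep_vars_compose2[OF indep_seed]) auto
    then have ind: "indep_vars (\<lambda>_. borel) (\<lambda>k X. X k - 1) {l, l'}"
      by (rule indep_vars_subset) simp
    show ?thesis
      using False m1 indep_vars_lebesgue_integral[OF _ ind] indep_vars_integrable[OF _ ind]
      by (simp add: prob_space)
  qed
  then show "integrable seed_law (\<lambda>X. (X l - 1) * (X l' - 1))"
    "(\<integral>X. (X l - 1) * (X l' - 1) \<partial>seed_law) = (if l = l' then 1 else 0)" by auto
qed

lemma seed_sum_L2:
  assumes S: "finite S"
  shows "integrable seed_law (\<lambda>X. (\<Sum>l\<in>S. c l * (X l - 1))\<^sup>2)"
    and "(\<integral>X. (\<Sum>l\<in>S. c l * (X l - 1))\<^sup>2 \<partial>seed_law) = (\<Sum>l\<in>S. (c l)\<^sup>2)"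
proof -
  have sq: "(\<Sum>l\<in>S. c l * (X l - 1))\<^sup>2 = (\<Sum>l\<in>S. \<Sum>l'\<in>S. (c l * c l') * ((X l - 1) * (X l' - 1)))" for X
    by (simp add: power2_eq_square sum_product ac_simps)
  show "integrable seed_law (\<lambda>X. (\<Sum>l\<in>S. c l * (X l - 1))\<^sup>2)"
    unfolding sq by (intro Bochner_Integration.integrable_sum integrable_mult_right seed_moments)
  have "(\<integral>X. (\<Sum>l\<in>S. c l * (X l - 1))\<^sup>2 \<partial>seed_law) = (\<Sum>l\<in>S. \<Sum>l'\<in>S. (c l * c l') * (if l = l' then 1 else 0))"
    unfolding sq by (simp add: seed_moments Bochner_Integration.integral_sum Bochner_Integration.integrable_sum)
  also have "\<dots> = (\<Sum>l\<in>S. (c l)\<^sup>2)"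
    using S by (simp add: power2_eq_square if_distrib cong: if_cong)
  finally show "(\<integral>X. (\<Sum>l\<in>S. c l * (X l - 1))\<^sup>2 \<partial>seed_law) = (\<Sum>l\<in>S. (c l)\<^sup>2)" .
qed

section \<open>Comparison of last-passage times\<close>

lemma lpp_nonneg: "(\<And>p. 0 \<le> w p) \<Longrightarrow> 0 \<le> lpp w i j"
  by (induction w i j rule: lpp.induct) (auto simp: le_max_iff_disj intro!: add_nonneg_nonneg)

lemma lpp_mono: "(\<And>p. w p \<le> w' p) \<Longrightarrow> lpp w i j \<le> lpp w' i j"
proof (induction w i j rule: lpp.induct)
  case (4 w i j)
  have "w (Suc i, Suc j) \<le> w' (Suc i, Suc j)" by (rule "4.prems")
  then show ?case using "4.IH"[OF "4.prems"] by (auto intro!: add_mono max.mono)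
qed (auto intro!: add_mono)

lemma lpp_row: "lpp w n 0 = (\<Sum>i<n. w (Suc i, 0))"
  by (induction n) auto

lemma lpp_column: "lpp w 0 n = (\<Sum>j<n. w (0, Suc j))"
  by (induction n) auto

lemma sum_lessThan_le:
  fixes f :: "nat \<Rightarrow> real"
  assumes "\<And>i. 0 \<le> f i" "n \<le> k" shows "(\<Sum>i<n. f i) \<le> (\<Sum>i<k. f i)"
  using assms by (intro sum_mono2) auto

text \<open>
  A geodesic for \<open>w\<close> follows one of the axes for a while before it enters the bulk. If it leaves
  the horizontal axis at or before \<open>K\<close>, or the vertical axis at or before \<open>L\<close>, then its bulk part is
  bounded by the last-passage time for \<open>v\<close>, which later has zero boundary weights. If it leaves the
  horizontal axis after \<open>K\<close>, then the same path gains at least \<open>lpp w' K 0 - lpp w K 0\<close> when the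
  boundary is enlarged to \<open>w'\<close>; likewise with \<open>w''\<close> on the vertical axis. Stated as one inequality
  between last-passage times, this follows from the recursion without mentioning paths.
\<close>

lemma lpp_tilt:
  assumes bulk: "\<And>i j. w (Suc i, Suc j) = v (Suc i, Suc j)"
      "\<And>i j. w' (Suc i, Suc j) = v (Suc i, Suc j)" "\<And>i j. w'' (Suc i, Suc j) = v (Suc i, Suc j)"
    and nonneg: "\<And>p. 0 \<le> v p" "\<And>p. 0 \<le> w p" "\<And>p. 0 \<le> w' p" "\<And>p. 0 \<le> w'' p"
    and row: "\<And>i. w (i, 0) \<le> w' (i, 0)" and col: "\<And>j. w (0, j) \<le> w'' (0, j)"
  shows "lpp w i j \<le> max (lpp v i j + lpp w K 0 + lpp w 0 L)
     (max (lpp w' i j - (lpp w' K 0 - lpp w K 0)) (lpp w'' i j - (lpp w'' 0 L - lpp w 0 L)))"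
    (is "_ \<le> ?B i j")
proof (rule lpp.induct[of "\<lambda>_ i j. lpp w i j \<le> ?B i j" v i j])
  show "lpp w 0 0 \<le> ?B 0 0" using lpp_nonneg[of w K 0] lpp_nonneg[of w 0 L] nonneg(2) by (simp add: le_max_iff_disj)
next
  fix i
  show "lpp w (Suc i) 0 \<le> ?B (Suc i) 0"
  proof (cases "Suc i \<le> K")
    case True
    have "lpp w (Suc i) 0 \<le> lpp w K 0"
      unfolding lpp_row using True nonneg(2) by (intro sum_lessThan_le)
    then have "lpp w (Suc i) 0 \<le> lpp v (Suc i) 0 + lpp w K 0 + lpp w 0 L"
      using lpp_nonneg[of w 0 L] lpp_nonneg[of v "Suc i" 0] nonneg by (smt (verit))
    then show ?thesis by (simp only: le_max_iff_disj simp_thms)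
  next
    case False
    have "(\<Sum>i<K. w' (Suc i, 0) - w (Suc i, 0)) \<le> (\<Sum>i<Suc i. w' (Suc i, 0) - w (Suc i, 0))"
      using False row by (intro sum_lessThan_le) auto
    then have "lpp w (Suc i) 0 \<le> lpp w' (Suc i) 0 - (lpp w' K 0 - lpp w K 0)"
      unfolding lpp_row sum_subtractf by linarith
    then show ?thesis by (simp only: le_max_iff_disj simp_thms)
  qed
next
  fix j
  show "lpp w 0 (Suc j) \<le> ?B 0 (Suc j)"
  proof (cases "Suc j \<le> L")
    case True
    have "lpp w 0 (Suc j) \<le> lpp w 0 L"
      unfolding lpp_column using True nonneg(2) by (intro sum_lessThan_le)
    then have "lpp w 0 (Suc j) \<le> lpp v 0 (Suc j) + lpp w K 0 + lpp w 0 L"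
      using lpp_nonneg[of w K 0] lpp_nonneg[of v 0 "Suc j"] nonneg by (smt (verit))
    then show ?thesis by (simp only: le_max_iff_disj simp_thms)
  next
    case False
    have "(\<Sum>j<L. w'' (0, Suc j) - w (0, Suc j)) \<le> (\<Sum>j<Suc j. w'' (0, Suc j) - w (0, Suc j))"
      using False col by (intro sum_lessThan_le) auto
    then have "lpp w 0 (Suc j) \<le> lpp w'' 0 (Suc j) - (lpp w'' 0 L - lpp w 0 L)"
      unfolding lpp_column sum_subtractf by linarith
    then show ?thesis by (simp only: le_max_iff_disj simp_thms)
  qed
next
  fix i j
  assume IH: "lpp w i (Suc j) \<le> ?B i (Suc j)" "lpp w (Suc i) j \<le> ?B (Suc i) j"
  have step: "v (Suc i, Suc j) + ?B i (Suc j) \<le> ?B (Suc i) (Suc j)"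
    "v (Suc i, Suc j) + ?B (Suc i) j \<le> ?B (Suc i) (Suc j)"
    by (auto simp: bulk max_def)
  have "v (Suc i, Suc j) + lpp w i (Suc j) \<le> ?B (Suc i) (Suc j)"
    by (rule order_trans[OF add_left_mono[OF IH(1)] step(1)])
  moreover have "v (Suc i, Suc j) + lpp w (Suc i) j \<le> ?B (Suc i) (Suc j)"
    by (rule order_trans[OF add_left_mono[OF IH(2)] step(2)])
  ultimately show "lpp w (Suc i) (Suc j) \<le> ?B (Suc i) (Suc j)"
    unfolding lpp.simps(4)[of w] bulk(1) max_add_distrib_right by (rule max.boundedI)
qed

section \<open>Directed paths and the recursion\<close>

definition bulk_weights :: "(nat \<times> nat \<Rightarrow> real) \<Rightarrow> (nat \<times> nat \<Rightarrow> real)" where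
  "bulk_weights w = (\<lambda>(i, j). if i = 0 \<or> j = 0 then 0 else w (i, j))"

lemma bulk_weights_Suc [simp]: "bulk_weights w (Suc i, Suc j) = w (Suc i, Suc j)"
  by (simp add: bulk_weights_def)

lemma lpp_bulk_boundary [simp]: "lpp (bulk_weights w) i 0 = 0" "lpp (bulk_weights w) 0 j = 0"
  by (simp_all add: lpp_row lpp_column bulk_weights_def)

lemma path_sum_le_lpp:
  assumes w: "\<And>i j. 0 \<le> w (Suc i, Suc j)"
  shows "\<pi> \<noteq> [] \<Longrightarrow> hd \<pi> = (1, 1) \<Longrightarrow> successively lattice_step \<pi> \<Longrightarrow>
    1 \<le> fst (last \<pi>) \<and> 1 \<le> snd (last \<pi>)
    \<and> (\<Sum>p\<leftarrow>\<pi>. w p) \<le> lpp (bulk_weights w) (fst (last \<pi>)) (snd (last \<pi>))"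
proof (induction \<pi> rule: rev_induct)
  case (snoc p \<pi>)
  show ?case
  proof (cases "\<pi> = []")
    case True
    then show ?thesis using snoc.prems by (simp add: bulk_weights_def)
  next
    case False
    then have s: "successively lattice_step \<pi>" "lattice_step (last \<pi>) p" and h: "hd \<pi> = (1, 1)"
      using snoc.prems by (auto simp: successively_append_iff)
    from snoc.IH[OF False h s(1)] obtain i j where ij: "last \<pi> = (Suc i, Suc j)"
      and le: "(\<Sum>p\<leftarrow>\<pi>. w p) \<le> lpp (bulk_weights w) (Suc i) (Suc j)"
      by (cases "last \<pi>") (auto simp: Suc_le_eq gr0_conv_Suc)
    have "p = (Suc (Suc i), Suc j) \<or> p = (Suc i, Suc (Suc j))"
      using s(2) by (auto simp: ij lattice_step_def)
    then show ?thesis using le by (auto simp: bulk_weights_def)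
  qed
qed simp

lemma lpp_attained:
  assumes w: "\<And>i j. 0 \<le> w (Suc i, Suc j)"
  shows "\<exists>\<pi>\<in>directed_paths (Suc i) (Suc j). (\<Sum>p\<leftarrow>\<pi>. w p) = lpp (bulk_weights w) (Suc i) (Suc j)"
proof (induction "i + j" arbitrary: i j rule: less_induct)
  case less
  have nn: "0 \<le> lpp (bulk_weights w) i j" for i j
    by (rule lpp_nonneg) (auto simp: bulk_weights_def w gr0_conv_Suc)
  let ?G = "lpp (bulk_weights w)"
  have ext: "\<exists>\<pi>\<in>directed_paths (Suc i) (Suc j). (\<Sum>p\<leftarrow>\<pi>. w p) = ?G i' j' + w (Suc i, Suc j)"
    if "\<exists>\<pi>\<in>directed_paths i' j'. (\<Sum>p\<leftarrow>\<pi>. w p) = ?G i' j'"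
       "lattice_step (i', j') (Suc i, Suc j)" for i' j'
  proof -
    from that(1) obtain \<pi> where \<pi>: "\<pi> \<in> directed_paths i' j'" "(\<Sum>p\<leftarrow>\<pi>. w p) = ?G i' j'" by blast
    then show ?thesis using that(2)
      by (intro bexI[of _ "\<pi> @ [(Suc i, Suc j)]"]) (auto simp: directed_paths_def successively_append_iff)
  qed
  consider (origin) "i = 0" "j = 0" | (left) i' where "i = Suc i'" "?G i (Suc j) \<ge> ?G (Suc i) j"
    | (down) j' where "j = Suc j'" "?G i (Suc j) \<le> ?G (Suc i) j"
    using nn[of i "Suc j"] nn[of "Suc i" j] linear[of "?G (Suc i) j" "?G i (Suc j)"]
    by (cases i; cases j) (auto simp del: lpp.simps)
  then show ?case
  proof cases
    case origin
    then show ?thesis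
      by (intro bexI[of _ "[(1, 1)]"]) (auto simp: directed_paths_def bulk_weights_def)
  next
    case left
    have "\<exists>\<pi>\<in>directed_paths i (Suc j). (\<Sum>p\<leftarrow>\<pi>. w p) = ?G i (Suc j)"
      using less[of i' j] left by simp
    from ext[OF this] left(2) show ?thesis by (simp add: lattice_step_def max_absorb1 add.commute)
  next
    case down
    have "\<exists>\<pi>\<in>directed_paths (Suc i) j. (\<Sum>p\<leftarrow>\<pi>. w p) = ?G (Suc i) j"
      using less[of i j'] down by simp
    from ext[OF this] down(2) show ?thesis by (simp add: lattice_step_def max_absorb2 add.commute)
  qed
qed

lemma last_passage_eq_lpp:
  assumes w: "\<And>i j. 0 \<le> w (Suc i, Suc j)" and "m \<ge> 1" "n \<ge> 1"
  shows "last_passage w m n = lpp (bulk_weights w) m n"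
  unfolding last_passage_def
proof (rule Max_eqI)
  show "finite ((\<lambda>\<pi>. \<Sum>p\<leftarrow>\<pi>. w p) ` directed_paths m n)"
    using directed_paths_finite_nonempty[OF assms(2,3)] by simp
  show "y \<le> lpp (bulk_weights w) m n" if "y \<in> (\<lambda>\<pi>. \<Sum>p\<leftarrow>\<pi>. w p) ` directed_paths m n" for y
  proof -
    from that obtain \<pi> where \<pi>: "\<pi> \<in> directed_paths m n" "y = (\<Sum>p\<leftarrow>\<pi>. w p)" by blast
    then show ?thesis using path_sum_le_lpp[of w \<pi>] w by (auto simp: directed_paths_def)
  qed
  show "lpp (bulk_weights w) m n \<in> (\<lambda>\<pi>. \<Sum>p\<leftarrow>\<pi>. w p) ` directed_paths m n"
    using lpp_attained[of w "m - 1" "n - 1"] w assms(2,3) by (auto simp: image_iff) metis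
qed

section \<open>Law of large numbers for the stationary model\<close>

text \<open>
  The environment is extended by \<open>a 0 = -z\<close> and \<open>b 0 = z\<close>: boundary weights are exponential with rates
  \<open>a i + z\<close> and \<open>b j - z\<close>. The parameter \<open>z\<close> enters only through the boundary rates, so the models for
  all \<open>z\<close> are coupled monotonically through the same field \<open>X\<close>.
\<close>

definition stationary_weights ::
    "(nat \<Rightarrow> real) \<Rightarrow> (nat \<Rightarrow> real) \<Rightarrow> real \<Rightarrow> (nat \<times> nat \<Rightarrow> real) \<Rightarrow> (nat \<times> nat \<Rightarrow> real)" where
  "stationary_weights a b z = weights (a(0 := - z)) (b(0 := z))"

lemma stationary_weights_simps [simp]:
  "stationary_weights a b z X (Suc i, 0) = X (Suc i, 0) / (a (Suc i) + z)"
  "stationary_weights a b z X (0, Suc j) = X (0, Suc j) / (b (Suc j) - z)"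
  "stationary_weights a b z X (Suc i, Suc j) = X (Suc i, Suc j) / (a (Suc i) + b (Suc j))"
  "stationary_weights a b z X (0, 0) = 0"
  by (simp_all add: stationary_weights_def weights_def)

definition grid :: "real \<Rightarrow> nat \<Rightarrow> nat" where
  "grid c n = nat \<lfloor>real n * c\<rfloor>"

lemma grid_le: "c \<ge> 0 \<Longrightarrow> real (grid c n) \<le> c * real n"
  unfolding grid_def by (simp add: mult.commute)

lemma grid_ratio: assumes "c > 0" shows "(\<lambda>n. real (grid c n) / real n) \<longlonglongrightarrow> c"
proof (rule real_tendsto_sandwich)
  have "c - 1 / real n \<le> real (grid c n) / real n" if "n \<ge> 1" for n
  proof -
    have "real n * c - 1 \<le> real (grid c n)" unfolding grid_def using assms by linarith
    then have "(real n * c - 1) / real n \<le> real (grid c n) / real n" by (intro divide_right_mono) auto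
    then show ?thesis using that by (simp add: diff_divide_distrib)
  qed
  then show "\<forall>\<^sub>F n in sequentially. c - 1 / real n \<le> real (grid c n) / real n"
    by (auto simp: eventually_sequentially)
  show "\<forall>\<^sub>F n in sequentially. real (grid c n) / real n \<le> c"
    using grid_le[of c] assms
    by (intro eventually_sequentiallyI[of 1]) (simp add: pos_divide_le_eq)
  show "(\<lambda>n. c - 1 / real n) \<longlonglongrightarrow> c"
    using tendsto_diff[OF tendsto_const lim_1_over_n, of c] by simp
qed simp

lemma grid_at_top: assumes "c > 0" shows "filterlim (grid c) at_top sequentially"
proof -
  have "filterlim (\<lambda>n. c * real n) at_top sequentially"
    by (rule filterlim_tendsto_pos_mult_at_top[OF tendsto_const assms filterlim_real_sequentially])
  then have "filterlim (\<lambda>n. real n * c) at_top sequentially" by (simp add: mult.commute)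
  then show ?thesis unfolding grid_def
    by (rule filterlim_compose[OF filterlim_nat_sequentially filterlim_compose[OF filterlim_floor_sequentially]])
qed

lemma average_grid:
  assumes c: "c > 0" and A: "(\<lambda>n. (\<Sum>i<n. f i) / real n) \<longlonglongrightarrow> A"
  shows "(\<lambda>n. (\<Sum>i<grid c n. f i) / real n) \<longlonglongrightarrow> c * A"
proof -
  have "(\<lambda>n. real (grid c n) / real n * ((\<Sum>i<grid c n. f i) / real (grid c n))) \<longlonglongrightarrow> c * A"
    by (intro tendsto_mult grid_ratio[OF c] filterlim_compose[OF A grid_at_top[OF c]])
  then show ?thesis
    by (rule Lim_transform_eventually) (auto intro!: always_eventually)
qed

lemma l2_null_average:
  fixes S :: "nat \<Rightarrow> 'i set"
  assumes S: "\<And>n. finite (S n)" "\<And>n. real (card (S n)) \<le> D * real n"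
    and c: "\<And>n l. l \<in> S n \<Longrightarrow> \<bar>c l\<bar> \<le> C"
  shows "l2_null seed_law (\<lambda>n X. (\<Sum>l\<in>S n. c l * (X l - 1)) / real n)"
  unfolding l2_null_def
proof (intro conjI allI)
  fix n
  show "(\<lambda>X. (\<Sum>l\<in>S n. c l * (X l - 1)) / real n) \<in> borel_measurable seed_law" by measurable
  show "integrable seed_law (\<lambda>X. ((\<Sum>l\<in>S n. c l * (X l - 1)) / real n)\<^sup>2)"
    using seed_sum_L2(1)[OF S(1), of c n] by (simp add: power_divide)
next
  have eq: "(\<integral>X. ((\<Sum>l\<in>S n. c l * (X l - 1)) / real n)\<^sup>2 \<partial>seed_law) = (\<Sum>l\<in>S n. (c l)\<^sup>2) / (real n)\<^sup>2" for n
    using seed_sum_L2[OF S(1), of c n] by (simp add: power_divide)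
  have "(\<Sum>l\<in>S n. (c l)\<^sup>2) / (real n)\<^sup>2 \<le> D * C\<^sup>2 * (1 / real n)" if "n \<ge> 1" for n
  proof -
    have "(\<Sum>l\<in>S n. (c l)\<^sup>2) \<le> real (card (S n)) * C\<^sup>2"
      using c by (intro sum_bounded_above) (auto simp: abs_le_square_iff[symmetric] intro: order_trans[OF _ abs_ge_self])
    also have "\<dots> \<le> D * real n * C\<^sup>2" using S(2) by (intro mult_right_mono) auto
    finally show ?thesis using that by (simp add: power2_eq_square field_simps)
  qed
  then have ub: "\<forall>\<^sub>F n in sequentially. (\<Sum>l\<in>S n. (c l)\<^sup>2) / (real n)\<^sup>2 \<le> D * C\<^sup>2 * (1 / real n)"
    by (rule eventually_sequentiallyI)
  show "(\<lambda>n. \<integral>X. ((\<Sum>l\<in>S n. c l * (X l - 1)) / real n)\<^sup>2 \<partial>seed_law) \<longlonglongrightarrow> 0"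
    unfolding eq
    by (rule real_tendsto_sandwich[OF _ ub tendsto_const])
       (use tendsto_mult_right_zero[OF lim_1_over_n, of "D * C\<^sup>2"] in \<open>auto simp: sum_nonneg\<close>)
qed

lemma row_fluctuation:
  assumes d: "d > 0" "\<And>i. d \<le> a (Suc i) + z" and c: "c \<ge> 0"
  shows "l2_null seed_law (\<lambda>n X. (lpp (stationary_weights a b z X) (grid c n) 0
            - (\<Sum>i<grid c n. 1 / (a (Suc i) + z))) / real n)"
proof -
  let ?c = "\<lambda>l::nat \<times> nat. 1 / (a (fst l) + z)" and ?S = "\<lambda>n. (\<lambda>i. (Suc i, 0::nat)) ` {..<grid c n}"
  have inj: "inj_on (\<lambda>i. (Suc i, 0::nat)) I" for I by (auto simp: inj_on_def)
  have "l2_null seed_law (\<lambda>n X. (\<Sum>l\<in>?S n. ?c l * (X l - 1)) / real n)"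
  proof (rule l2_null_average)
    show "real (card (?S n)) \<le> c * real n" for n using grid_le[OF c, of n] by (simp add: card_image[OF inj])
    show "\<bar>?c l\<bar> \<le> 1 / d" if "l \<in> ?S n" for l n
    proof -
      from that obtain i where "fst l = Suc i" by auto
      then show ?thesis using d(1) d(2)[of i] by (auto intro!: divide_left_mono mult_pos_pos)
    qed
  qed auto
  moreover have "(\<Sum>l\<in>?S n. ?c l * (X l - 1)) = lpp (stationary_weights a b z X) (grid c n) 0
            - (\<Sum>i<grid c n. 1 / (a (Suc i) + z))" for n X
    by (simp add: sum.reindex[OF inj] lpp_row sum_subtractf[symmetric] diff_divide_distrib)
  ultimately show ?thesis by simp
qed

lemma column_fluctuation:
  assumes d: "d > 0" "\<And>j. d \<le> b (Suc j) - z" and c: "c \<ge> 0"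
  shows "l2_null seed_law (\<lambda>n X. (lpp (stationary_weights a b z X) 0 (grid c n)
            - (\<Sum>j<grid c n. 1 / (b (Suc j) - z))) / real n)"
proof -
  let ?c = "\<lambda>l::nat \<times> nat. 1 / (b (snd l) - z)" and ?S = "\<lambda>n. (\<lambda>j. (0::nat, Suc j)) ` {..<grid c n}"
  have inj: "inj_on (\<lambda>j. (0::nat, Suc j)) I" for I by (auto simp: inj_on_def)
  have "l2_null seed_law (\<lambda>n X. (\<Sum>l\<in>?S n. ?c l * (X l - 1)) / real n)"
  proof (rule l2_null_average)
    show "real (card (?S n)) \<le> c * real n" for n using grid_le[OF c, of n] by (simp add: card_image[OF inj])
    show "\<bar>?c l\<bar> \<le> 1 / d" if "l \<in> ?S n" for l n
    proof -
      from that obtain j where "snd l = Suc j" by auto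
      then show ?thesis using d(1) d(2)[of j] by (auto intro!: divide_left_mono mult_pos_pos)
    qed
  qed auto
  moreover have "(\<Sum>l\<in>?S n. ?c l * (X l - 1)) = lpp (stationary_weights a b z X) 0 (grid c n)
            - (\<Sum>j<grid c n. 1 / (b (Suc j) - z))" for n X
    by (simp add: sum.reindex[OF inj] lpp_column sum_subtractf[symmetric] diff_divide_distrib)
  ultimately show ?thesis by simp
qed

lemma l2_null_preserving:
  assumes e: "l2_null M e" and T: "\<And>n. measure_preserving_map M (T n)"
  shows "l2_null M (\<lambda>n x. e n (T n x))"
proof -
  have [measurable]: "T n \<in> M \<rightarrow>\<^sub>M M" "e n \<in> borel_measurable M" and D: "distr M M (T n) = M" for n
    using T[of n] e by (auto simp: measure_preserving_map_def l2_null_def)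
  have "integrable M (\<lambda>x. (e n (T n x))\<^sup>2)" for n
    using integrable_distr_eq[of "T n" M M "\<lambda>x. (e n x)\<^sup>2"] e by (simp add: D l2_null_def)
  moreover have "(\<integral>x. (e n (T n x))\<^sup>2 \<partial>M) = (\<integral>x. (e n x)\<^sup>2 \<partial>M)" for n
    using integral_distr[of "T n" M M "\<lambda>x. (e n x)\<^sup>2"] by (simp add: D)
  ultimately show ?thesis using e by (simp add: l2_null_def)
qed

text \<open>
  The increments along column \<open>m n\<close> depend on all of the field to its left, but by Burke's property
  they are jointly distributed as the weights on the vertical axis, whose sum satisfies the estimate
  for independent exponentials.
\<close>

lemma increment_fluctuation:
  assumes d: "d > 0" "\<And>i. d \<le> a (Suc i) + z" "\<And>j. d \<le> b (Suc j) - z" and c: "c \<ge> 0"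
  shows "l2_null seed_law (\<lambda>n X. (lpp (stationary_weights a b z X) (m n) (grid c n)
            - lpp (stationary_weights a b z X) (m n) 0 - (\<Sum>j<grid c n. 1 / (b (Suc j) - z))) / real n)"
proof -
  let ?a = "a(0 := - z)" and ?b = "b(0 := z)"
  let ?G = "\<lambda>X. lpp (stationary_weights a b z X)"
  have pos: "?a i + ?b j > 0" if "(i, j) \<noteq> (0, 0)" for i j
    using that d(1) d(2)[of "i - 1"] d(3)[of "j - 1"] by (cases i; cases j) auto
  have "\<forall>n. \<exists>T. measure_preserving_map seed_law T \<and>
      (\<forall>X. \<forall>k<grid c n. stationary_weights a b z (T X) (0, Suc k) = ?G X (m n) (Suc k) - ?G X (m n) k)"
    using burke_column[of ?a ?b, OF pos] unfolding stationary_weights_def by (simp add: fun_upd_same) meson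
  then obtain T where T: "\<And>n. measure_preserving_map seed_law (T n)"
    "\<And>n X k. k < grid c n \<Longrightarrow> stationary_weights a b z (T n X) (0, Suc k) = ?G X (m n) (Suc k) - ?G X (m n) k"
    by metis
  have "lpp (stationary_weights a b z (T n X)) 0 (grid c n) = ?G X (m n) (grid c n) - ?G X (m n) 0" for n X
  proof -
    have "lpp (stationary_weights a b z (T n X)) 0 (grid c n)
        = (\<Sum>k<grid c n. ?G X (m n) (Suc k) - ?G X (m n) k)"
      unfolding lpp_column by (intro sum.cong refl T(2)) simp
    then show ?thesis by (simp add: sum_lessThan_telescope)
  qed
  with l2_null_preserving[where T=T, OF column_fluctuation[where d=d and a=a and b=b and z=z and c=c, OF d(1,3) c] T(1)]
  show ?thesis by simp
qed

section \<open>Bounds in a fixed environment\<close>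

lemma AE_seed_nonneg: "AE X in (seed_law :: (nat \<times> nat \<Rightarrow> real) measure). \<forall>p. 0 \<le> X p"
proof -
  interpret prob_space "seed_law :: (nat \<times> nat \<Rightarrow> real) measure" by (rule prob_space_seed_law)
  show ?thesis unfolding AE_all_countable
  proof
  fix p :: "nat \<times> nat"
  show "AE X in seed_law. 0 \<le> X p"
    by (subst distributed_AE2[OF seed_component_distributed]) (auto simp: exponential_density_def)
  qed
qed

text \<open>
  With \<open>f w = s * A w + t * B w\<close>, the last-passage time of the stationary model with parameter \<open>w\<close> grows
  like \<open>n * f w\<close>. It dominates the bulk, which is the upper bound. The conditions \<open>left\<close> and \<open>right\<close>
  say that an exit from an axis beyond \<open>\<epsilon> * n\<close> would cost more than the tilted models with
  parameters \<open>z'\<close> and \<open>z''\<close> allow. So the first alternative in \<open>lpp_tilt\<close> must hold for large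
  \<open>n\<close>, and the bulk loses at most the boundary weights up to \<open>\<epsilon> * n\<close>.
\<close>

theorem quenched_bounds:
  assumes d: "d > 0" "\<And>i w. w \<in> {z, z', z''} \<Longrightarrow> d \<le> a (Suc i) + w"
      "\<And>j w. w \<in> {z, z', z''} \<Longrightarrow> d \<le> b (Suc j) - w"
    and z: "z' < z" "z < z''"
    and A: "\<And>w. w \<in> {z, z', z''} \<Longrightarrow> (\<lambda>n. (\<Sum>i<n. 1 / (a (Suc i) + w)) / real n) \<longlonglongrightarrow> A w"
    and B: "\<And>w. w \<in> {z, z', z''} \<Longrightarrow> (\<lambda>n. (\<Sum>j<n. 1 / (b (Suc j) - w)) / real n) \<longlonglongrightarrow> B w"
    and pos: "s > 0" "t > 0" "\<epsilon> > 0"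
    and left: "s * A z' + t * B z' - \<epsilon> * (A z' - A z) < s * A z + t * B z"
    and right: "s * A z'' + t * B z'' - \<epsilon> * (B z'' - B z) < s * A z + t * B z"
    and lim: "AE X in seed_law. (\<lambda>n. ereal (lpp (bulk_weights (\<lambda>(i, j). X (i, j) / (a i + b j)))
        (grid s n) (grid t n) / real n)) \<longlonglongrightarrow> \<gamma>"
  shows "ereal (s * A z + t * B z - \<epsilon> * (A z + B z)) \<le> \<gamma>" "\<gamma> \<le> ereal (s * A z + t * B z)"
proof -
  interpret prob_space "seed_law :: (nat \<times> nat \<Rightarrow> real) measure" by (rule prob_space_seed_law)
  let ?Z = "{z, z', z''}"
  let ?w = "stationary_weights a b"
  let ?v = "\<lambda>X. bulk_weights (\<lambda>(i, j). X (i, j) / (a i + b j))"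
  define row :: "real \<Rightarrow> real \<Rightarrow> nat \<Rightarrow> (nat \<times> nat \<Rightarrow> real) \<Rightarrow> real" where
    "row w c = (\<lambda>n X. (lpp (?w w X) (grid c n) 0 - (\<Sum>i<grid c n. 1 / (a (Suc i) + w))) / real n)" for w c
  define col :: "real \<Rightarrow> nat \<Rightarrow> (nat \<times> nat \<Rightarrow> real) \<Rightarrow> real" where
    "col w = (\<lambda>n X. (lpp (?w w X) 0 (grid \<epsilon> n) - (\<Sum>j<grid \<epsilon> n. 1 / (b (Suc j) - w))) / real n)" for w
  define inc :: "real \<Rightarrow> nat \<Rightarrow> (nat \<times> nat \<Rightarrow> real) \<Rightarrow> real" where
    "inc w = (\<lambda>n X. (lpp (?w w X) (grid s n) (grid t n)
            - lpp (?w w X) (grid s n) 0 - (\<Sum>j<grid t n. 1 / (b (Suc j) - w))) / real n)" for w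
  let ?E = "(\<lambda>w. row w s) ` ?Z \<union> (\<lambda>w. row w \<epsilon>) ` ?Z \<union> col ` ?Z \<union> inc ` ?Z"
  have row_null: "l2_null seed_law (row w c)" if "w \<in> ?Z" "c > 0" for w c
    unfolding row_def by (rule row_fluctuation[where d=d]) (use d(1) d(2)[OF that(1)] that(2) in auto)
  have col_null: "l2_null seed_law (col w)" if "w \<in> ?Z" for w
    unfolding col_def by (rule column_fluctuation[where d=d]) (use d(1) d(3)[OF that] pos in auto)
  have inc_null: "l2_null seed_law (inc w)" if "w \<in> ?Z" for w
    unfolding inc_def by (rule increment_fluctuation[where d=d]) (use d(1) d(2,3)[OF that] pos in auto)
  have "\<exists>r::nat \<Rightarrow> nat. strict_mono r \<and> (AE X in seed_law. \<forall>e\<in>?E. (\<lambda>n. e (r n) X) \<longlonglongrightarrow> 0)"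
    by (rule l2_null_subseq) (use row_null col_null inc_null pos in \<open>auto simp del: insert_iff\<close>)
  then obtain r :: "nat \<Rightarrow> nat" where r: "strict_mono r"
    and null: "AE X in seed_law. \<forall>e\<in>?E. (\<lambda>n. e (r n) X) \<longlonglongrightarrow> 0" by blast
  from AE_seed_nonneg null lim have "AE X in (seed_law :: (nat \<times> nat \<Rightarrow> real) measure).
     \<exists>X. (\<forall>p. 0 \<le> X p) \<and> (\<forall>e\<in>?E. (\<lambda>n. e (r n) X) \<longlonglongrightarrow> 0)
       \<and> (\<lambda>n. ereal (lpp (?v X) (grid s n) (grid t n) / real n)) \<longlonglongrightarrow> \<gamma>"
  proof eventually_elim
    case (elim X) then show ?case by (intro exI[of _ X] conjI)
  qed
  then obtain X where X: "\<And>p. 0 \<le> X p" and E: "\<And>e. e \<in> ?E \<Longrightarrow> (\<lambda>n. e (r n) X) \<longlonglongrightarrow> 0"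
    and G: "(\<lambda>n. ereal (lpp (?v X) (grid s n) (grid t n) / real n)) \<longlonglongrightarrow> \<gamma>"
    by (subst (asm) AE_const) blast
  have rt: "filterlim r at_top sequentially" by (rule filterlim_subseq[OF r])
  have row_lim: "(\<lambda>n. lpp (?w w X) (grid c (r n)) 0 / real (r n)) \<longlonglongrightarrow> c * A w"
    if "w \<in> ?Z" "c \<in> {s, \<epsilon>}" for w c
  proof -
    have "row w c \<in> ?E" using that by blast
    from tendsto_add[OF E[OF this] filterlim_compose[OF average_grid[OF _ A[OF that(1)], of c] rt]]
    show ?thesis using that(2) pos by (auto simp: row_def diff_divide_distrib)
  qed
  have col_lim: "(\<lambda>n. lpp (?w w X) 0 (grid \<epsilon> (r n)) / real (r n)) \<longlonglongrightarrow> \<epsilon> * B w" if "w \<in> ?Z" for w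
  proof -
    have "col w \<in> ?E" using that by blast
    from tendsto_add[OF E[OF this] filterlim_compose[OF average_grid[OF _ B[OF that(1)], of \<epsilon>] rt]]
    show ?thesis using pos by (simp add: col_def diff_divide_distrib)
  qed
  have full: "(\<lambda>n. lpp (?w w X) (grid s (r n)) (grid t (r n)) / real (r n)) \<longlonglongrightarrow> s * A w + t * B w"
    if "w \<in> ?Z" for w
  proof -
    have "inc w \<in> ?E" using that by blast
    from tendsto_add[OF tendsto_add[OF E[OF this]
          filterlim_compose[OF average_grid[OF _ B[OF that(1)], of t] rt]] row_lim[OF that, of s]]
    show ?thesis using pos by (simp add: inc_def diff_divide_distrib add.commute)
  qed
  have wpos: "0 < a (Suc i) + w" "0 < b (Suc j) - w" "0 < a (Suc i) + b (Suc j)" if "w \<in> ?Z" for w i j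
    using d(1) d(2)[OF that, of i] d(3)[OF that, of j] by linarith+
  have nonneg: "0 \<le> ?w w X p" if "w \<in> ?Z" for w p
    using X wpos[OF that] by (cases p; cases "fst p"; cases "snd p") (auto intro!: divide_nonneg_pos)
  have vnonneg: "0 \<le> ?v X p" for p
    using X wpos(3)[of z] by (cases p; cases "fst p"; cases "snd p") (auto simp: bulk_weights_def intro!: divide_nonneg_pos)
  have G': "(\<lambda>n. ereal (lpp (?v X) (grid s (r n)) (grid t (r n)) / real (r n))) \<longlonglongrightarrow> \<gamma>"
    by (rule filterlim_compose[OF G rt])
  have le: "lpp (?v X) i j \<le> lpp (?w z X) i j" for i j
  proof (rule lpp_mono)
    show "?v X p \<le> ?w z X p" for p
      using nonneg[of z p] by (cases p; cases "fst p"; cases "snd p") (auto simp: bulk_weights_def)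
  qed
  show "\<gamma> \<le> ereal (s * A z + t * B z)"
    by (rule LIMSEQ_le[OF G' tendsto_ereal[OF full[of z]]]) (auto intro!: divide_right_mono le)
  let ?G = "\<lambda>w n. lpp (?w w X) (grid s (r n)) (grid t (r n))"
  let ?K = "\<lambda>n. grid \<epsilon> (r n)"
  have tilt: "?G z n \<le> max (lpp (?v X) (grid s (r n)) (grid t (r n)) + lpp (?w z X) (?K n) 0 + lpp (?w z X) 0 (?K n))
     (max (?G z' n - (lpp (?w z' X) (?K n) 0 - lpp (?w z X) (?K n) 0))
          (?G z'' n - (lpp (?w z'' X) 0 (?K n) - lpp (?w z X) 0 (?K n))))" for n
  proof (rule lpp_tilt)
    show "?w z X (i, 0) \<le> ?w z' X (i, 0)" for i
      using X wpos(1)[of z'] z by (cases i) (auto intro!: divide_left_mono mult_pos_pos wpos)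
    show "?w z X (0, j) \<le> ?w z'' X (0, j)" for j
      using X wpos(2)[of z''] z by (cases j) (auto intro!: divide_left_mono mult_pos_pos wpos)
  qed (use nonneg vnonneg in auto)
  have "(\<lambda>n. ?G z n / real (r n) - (?G z' n / real (r n)
       - (lpp (?w z' X) (?K n) 0 / real (r n) - lpp (?w z X) (?K n) 0 / real (r n))))
      \<longlonglongrightarrow> (s * A z + t * B z) - ((s * A z' + t * B z') - (\<epsilon> * A z' - \<epsilon> * A z))"
    by (intro tendsto_diff full row_lim) auto
  then have e1: "\<forall>\<^sub>F n in sequentially. 0 < ?G z n / real (r n) - (?G z' n / real (r n)
       - (lpp (?w z' X) (?K n) 0 / real (r n) - lpp (?w z X) (?K n) 0 / real (r n)))"
    by (rule order_tendstoD(1)) (use left in \<open>simp add: right_diff_distrib\<close>)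
  have "(\<lambda>n. ?G z n / real (r n) - (?G z'' n / real (r n)
       - (lpp (?w z'' X) 0 (?K n) / real (r n) - lpp (?w z X) 0 (?K n) / real (r n))))
      \<longlonglongrightarrow> (s * A z + t * B z) - ((s * A z'' + t * B z'') - (\<epsilon> * B z'' - \<epsilon> * B z))"
    by (intro tendsto_diff full col_lim) auto
  then have e2: "\<forall>\<^sub>F n in sequentially. 0 < ?G z n / real (r n) - (?G z'' n / real (r n)
       - (lpp (?w z'' X) 0 (?K n) / real (r n) - lpp (?w z X) 0 (?K n) / real (r n)))"
    by (rule order_tendstoD(1)) (use right in \<open>simp add: right_diff_distrib\<close>)
  have "\<forall>\<^sub>F n in sequentially. ?G z n / real (r n) - (lpp (?w z X) (?K n) 0 / real (r n) + lpp (?w z X) 0 (?K n) / real (r n))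
       \<le> lpp (?v X) (grid s (r n)) (grid t (r n)) / real (r n)"
    using e1 e2
  proof eventually_elim
    case (elim n)
    have r0: "real (r n) > 0"
      using elim(1) by (cases "r n = 0") auto
    have "?G z' n - (lpp (?w z' X) (?K n) 0 - lpp (?w z X) (?K n) 0) < ?G z n"
      using elim(1) r0 by (simp add: diff_divide_distrib[symmetric] zero_less_divide_iff)
    moreover have "?G z'' n - (lpp (?w z'' X) 0 (?K n) - lpp (?w z X) 0 (?K n)) < ?G z n"
      using elim(2) r0 by (simp add: diff_divide_distrib[symmetric] zero_less_divide_iff)
    ultimately have "?G z n \<le> lpp (?v X) (grid s (r n)) (grid t (r n)) + lpp (?w z X) (?K n) 0 + lpp (?w z X) 0 (?K n)"
      using tilt[of n] by linarith
    then show ?case using r0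
      by (simp add: diff_divide_distrib[symmetric] add_divide_distrib[symmetric] divide_right_mono)
  qed
  then have ev: "\<exists>N. \<forall>n\<ge>N. ereal (?G z n / real (r n) - (lpp (?w z X) (?K n) 0 / real (r n) + lpp (?w z X) 0 (?K n) / real (r n)))
       \<le> ereal (lpp (?v X) (grid s (r n)) (grid t (r n)) / real (r n))"
    by (simp add: eventually_sequentially)
  have "(\<lambda>n. ?G z n / real (r n) - (lpp (?w z X) (?K n) 0 / real (r n) + lpp (?w z X) 0 (?K n) / real (r n)))
      \<longlonglongrightarrow> (s * A z + t * B z) - (\<epsilon> * A z + \<epsilon> * B z)"
    by (intro tendsto_diff tendsto_add full row_lim col_lim) auto
  then have "ereal ((s * A z + t * B z) - (\<epsilon> * A z + \<epsilon> * B z)) \<le> \<gamma>"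
    by (intro LIMSEQ_le[OF tendsto_ereal G' ev])
  then show "ereal (s * A z + t * B z - \<epsilon> * (A z + B z)) \<le> \<gamma>" by (simp add: algebra_simps)
qed

section \<open>From the annealed law to the field of unit exponentials\<close>

lemma distr_scaled_seed:
  assumes r: "r > 0"
  shows "distr seed_law borel (\<lambda>X. X p / r) = exp_law r"
proof (rule measure_eqI)
  fix A assume "A \<in> sets (distr seed_law borel (\<lambda>X. X p / r))"
  then have A[measurable]: "A \<in> sets borel" by simp
  have "distr seed_law (exp_law 1) (\<lambda>X. X p) = exp_law 1"
    by (rule distr_PiM_component) (auto intro: prob_space_exp_law_1)
  then have D: "distr seed_law borel (\<lambda>X. X p) = exp_law 1"
    by (metis distr_cong sets_exponential_distribution)
  have "emeasure (distr seed_law borel (\<lambda>X. X p / r)) A = (\<integral>\<^sup>+X. indicator A (X p / r) \<partial>seed_law)"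
    by (subst nn_integral_indicator[symmetric], simp, subst nn_integral_distr) auto
  also have "\<dots> = (\<integral>\<^sup>+x. indicator A (x / r) \<partial>distr seed_law borel (\<lambda>X. X p))"
    by (subst nn_integral_distr) auto
  also have "\<dots> = (\<integral>\<^sup>+x. indicator A x \<partial>exp_law r)"
    unfolding D by (rule nn_integral_exponential_scale[OF _ r]) measurable
  also have "\<dots> = emeasure (exp_law r) A" by (subst nn_integral_indicator) auto
  finally show "emeasure (distr seed_law borel (\<lambda>X. X p / r)) A = emeasure (exp_law r) A" .
qed simp

lemma quenched_law_eq_distr:
  assumes pos: "\<And>i j. i \<ge> 1 \<Longrightarrow> j \<ge> 1 \<Longrightarrow> a i + b j > 0"
  shows "quenched_law a b
    = distr seed_law weight_space (\<lambda>X. \<lambda>(i, j)\<in>{1..} \<times> {1..}. X (i, j) / (a i + b j))"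
proof -
  let ?I = "{1..} \<times> {1..} :: (nat \<times> nat) set" and ?r = "\<lambda>(i, j). a i + b j"
  interpret prob_space "seed_law :: (nat \<times> nat \<Rightarrow> real) measure" by (rule prob_space_seed_law)
  have "indep_vars (\<lambda>_. borel) (\<lambda>p X. X p / ?r p) (UNIV :: (nat \<times> nat) set)"
    by (rule indep_vars_compose2[OF indep_seed]) auto
  then have ind: "indep_vars (\<lambda>_. borel) (\<lambda>p X. X p / ?r p) ?I"
    by (rule indep_vars_subset) simp
  have "?I \<noteq> {}" by auto
  then have "distr seed_law (PiM ?I (\<lambda>_. borel)) (\<lambda>X. \<lambda>p\<in>?I. X p / ?r p)
      = PiM ?I (\<lambda>p. distr seed_law borel (\<lambda>X. X p / ?r p))"
    using indep_vars_iff_distr_eq_PiM'[of ?I "\<lambda>p X. X p / ?r p" "\<lambda>_. borel"] ind by auto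
  also have "\<dots> = quenched_law a b"
    unfolding quenched_law_def
    by (rule PiM_cong) (auto intro!: distr_scaled_seed pos)
  finally show ?thesis unfolding weight_space_def
    by (simp add: case_prod_beta' restrict_def cong: if_cong)
qed

text \<open>
  The property may fail to be measurable, so the argument passes through a measurable null set that
  contains its exceptions.
\<close>

lemma AE_annealed_imp_AE_quenched:
  assumes \<mu>: "prob_space \<mu>" "sets \<mu> = sets env_space"
    and P: "AE W in annealed_law \<mu>. P W"
  shows "AE (a, b) in \<mu>. AE W in quenched_law a b. P W"
proof -
  have K: "(\<lambda>(a, b). quenched_law a b) \<in> \<mu> \<rightarrow>\<^sub>M subprob_algebra weight_space"
    using measurable_prob_algebraD[OF quenched_law_measurable] \<mu>(2) by (simp cong: measurable_cong_sets)
  have ne: "space \<mu> \<noteq> {}" using \<mu>(1) by (rule prob_space.not_empty)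
  have SQ: "sets (quenched_law a b) = sets weight_space" for a b
    unfolding quenched_law_def weight_space_def by (rule sets_PiM_cong) auto
  have S: "sets (annealed_law \<mu>) = sets weight_space"
    unfolding annealed_law_def by (rule sets_bind[OF _ ne]) (auto simp: SQ)
  obtain N where N: "N \<in> null_sets (annealed_law \<mu>)" "{W \<in> space (annealed_law \<mu>). \<not> P W} \<subseteq> N"
    using P by (auto simp: eventually_ae_filter)
  then have Nm: "N \<in> sets weight_space" by (auto simp: S)
  have int0: "(\<integral>\<^sup>+x. emeasure (case x of (a, b) \<Rightarrow> quenched_law a b) N \<partial>\<mu>) = 0"
    using emeasure_annealed_law[OF \<mu> Nm] N(1) by (auto simp: case_prod_beta')
  have "(\<lambda>x. emeasure (case x of (a, b) \<Rightarrow> quenched_law a b) N) \<in> borel_measurable \<mu>"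
    using measurable_compose[OF K measurable_emeasure_subprob_algebra[OF Nm]] by simp
  from nn_integral_0_iff_AE[OF this] int0
  have "AE x in \<mu>. emeasure (case x of (a, b) \<Rightarrow> quenched_law a b) N = 0" by simp
  then show ?thesis
  proof eventually_elim
    case (elim x)
    obtain a b where x: "x = (a, b)" by (cases x)
    have "N \<in> null_sets (quenched_law a b)" using elim Nm SQ[of a b] by (auto simp: x)
    moreover have "{W \<in> space (quenched_law a b). \<not> P W} \<subseteq> N"
      using N(2) sets_eq_imp_space_eq[OF SQ[of a b]] sets_eq_imp_space_eq[OF S] by simp
    ultimately show ?case by (auto simp: x intro: AE_I')
  qed
qed

section \<open>Ergodic averages of the environment\<close>

lemma measure_preserving_funpow:
  "measure_preserving_map M T \<Longrightarrow> measure_preserving_map M (T ^^ n)"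
proof (induction n)
  case 0 show ?case by (simp add: measure_preserving_map_def distr_id[of M] id_def)
next
  case (Suc n) then show ?case using measure_preserving_comp[of M T "T ^^ n"] by (simp add: comp_def)
qed

lemma uniform_reciprocal_mean:
  fixes c l z :: real
  assumes l: "l > 0" and c: "c + z > 0"
  shows "(\<integral>x. 1 / (max x c + z) \<partial>uniform_measure lborel {c..c + l}) = ln ((c + l + z) / (c + z)) / l"
proof -
  have U: "uniform_measure lborel {c..c + l} = density lborel (\<lambda>x. ennreal ((indicator {c..c + l} x :: real) / l))"
    unfolding uniform_measure_def using l
    by (intro density_cong) (auto simp: divide_ennreal ennreal_indicator[symmetric] simp del: ennreal_indicator split: split_indicator)
  have "(\<integral>x. 1 / (max x c + z) \<partial>uniform_measure lborel {c..c + l})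
      = (\<integral>x. (indicator {c..c + l} x *\<^sub>R (1 / (x + z))) / l \<partial>lborel)"
    unfolding U using l
    by (subst integral_density) (auto intro!: Bochner_Integration.integral_cong split: split_indicator simp: max_def)
  also have "\<dots> = (\<integral>x. indicator {c..c + l} x *\<^sub>R (1 / (x + z)) \<partial>lborel) / l"
    by (rule integral_divide_zero)
  also have "(\<integral>x. indicator {c..c + l} x *\<^sub>R (1 / (x + z)) \<partial>lborel) = ln (c + l + z) - ln (c + z)"
  proof (rule integral_FTC_Icc)
    show "((\<lambda>x. ln (x + z)) has_vector_derivative 1 / (x + z)) (at x within {c..c + l})"
      if "c \<le> x" "x \<le> c + l" for x
      using that c
      by (intro has_real_derivative_iff_has_vector_derivative[THEN iffD1]) (auto intro!: derivative_eq_intros)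
    show "continuous_on {c..c + l} (\<lambda>x. 1 / (x + z))"
      using c by (intro continuous_intros) auto
  qed (use l in auto)
  finally show ?thesis using l c by (simp add: ln_div)
qed

text \<open>
  The reciprocals are bounded on the support of the uniform law. Off the support the observable is
  truncated from below at \<open>c\<close>, so that the ergodic theorem for functions bounded everywhere applies.
\<close>

lemma ergodic_observable_reciprocal:
  assumes M: "prob_space M" and T: "ergodic_map M T" and h[measurable]: "h \<in> borel_measurable M"
    and D: "distr M borel h = uniform_measure lborel {c..c + l}" and l: "l > 0"
    and Z: "finite Z" "\<And>z. z \<in> Z \<Longrightarrow> c + z > 0"
  shows "AE x in M. (\<forall>i. c \<le> h ((T ^^ i) x)) \<and> (\<forall>z\<in>Z.
     (\<lambda>n. (\<Sum>i<n. 1 / (h ((T ^^ i) x) + z)) / real n) \<longlonglongrightarrow> ln ((c + l + z) / (c + z)) / l)"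
proof -
  have mp: "measure_preserving_map M T" using T by (simp add: ergodic_map_def)
  have "AE y in uniform_measure lborel {c..c + l}. c \<le> y"
    by (rule AE_uniform_measureI) auto
  then have 0: "AE x in M. c \<le> h x"
    unfolding D[symmetric] by (rule AE_distrD[OF h])
  have low: "AE x in M. \<forall>i. c \<le> h ((T ^^ i) x)"
    unfolding AE_all_countable
  proof
    fix i
    have Ti: "T ^^ i \<in> M \<rightarrow>\<^sub>M M" and Di: "distr M M (T ^^ i) = M"
      using measure_preserving_funpow[OF mp, of i] by (auto simp: measure_preserving_map_def)
    have "AE x in distr M M (T ^^ i). c \<le> h x" unfolding Di by (rule 0)
    then show "AE x in M. c \<le> h ((T ^^ i) x)" by (rule AE_distrD[OF Ti])
  qed
  have lim: "AE x in M. \<forall>z\<in>Z. (\<lambda>n. (\<Sum>i<n. 1 / (max (h ((T ^^ i) x)) c + z)) / real n)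
      \<longlonglongrightarrow> ln ((c + l + z) / (c + z)) / l"
  proof (subst AE_finite_all[OF Z(1)], rule ballI)
    fix z assume z: "z \<in> Z"
    have "(\<integral>x. 1 / (max (h x) c + z) \<partial>M) = (\<integral>x. 1 / (max x c + z) \<partial>distr M borel h)"
      by (subst integral_distr) auto
    then have mean: "(\<integral>x. 1 / (max (h x) c + z) \<partial>M) = ln ((c + l + z) / (c + z)) / l"
      unfolding D using uniform_reciprocal_mean[OF l Z(2)[OF z]] by simp
    have bd: "\<bar>1 / (max (h x) c + z)\<bar> \<le> 1 / (c + z)" for x
      using Z(2)[OF z] by (auto intro!: divide_left_mono mult_pos_pos simp: max_def)
    have "(\<lambda>x. 1 / (max (h x) c + z)) \<in> borel_measurable M" by measurable
    from birkhoff_ergodic[OF M T this bd]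
    show "AE x in M. (\<lambda>n. (\<Sum>i<n. 1 / (max (h ((T ^^ i) x)) c + z)) / real n)
      \<longlonglongrightarrow> ln ((c + l + z) / (c + z)) / l"
      unfolding mean .
  qed
  from low lim show ?thesis by eventually_elim (simp add: max_absorb1)
qed

lemma funpow_map_prod_shift:
  "fst (((map_prod (shift 1) (shift 1)) ^^ i) x) 1 = fst x (Suc i)"
  "snd (((map_prod (shift 1) (shift 1)) ^^ i) x) 1 = snd x (Suc i)"
proof -
  have "fst (((map_prod (shift 1) (shift 1)) ^^ i) x) (Suc k) = fst x (Suc k + i)
      \<and> snd (((map_prod (shift 1) (shift 1)) ^^ i) x) (Suc k) = snd x (Suc k + i)" for k
    by (induction i arbitrary: k) (auto simp: shift_def)
  from this[of 0] show "fst (((map_prod (shift 1) (shift 1)) ^^ i) x) 1 = fst x (Suc i)"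
    "snd (((map_prod (shift 1) (shift 1)) ^^ i) x) 1 = snd x (Suc i)" by auto
qed

lemma first_entries_measurable:
  assumes "sets \<mu> = sets env_space"
  shows "(\<lambda>x. fst x 1) \<in> borel_measurable \<mu>" "(\<lambda>x. snd x 1) \<in> borel_measurable \<mu>"
proof -
  have c: "(\<lambda>a. a 1) \<in> borel_measurable pos_seq_space"
    using measurable_component_singleton[of 1 "{1..}" "\<lambda>_::nat. restrict_space borel {0<..} :: real measure"]
    unfolding pos_seq_space_def by (auto simp: measurable_restrict_space2_iff)
  have "(\<lambda>x. fst x 1) \<in> borel_measurable env_space" "(\<lambda>x. snd x 1) \<in> borel_measurable env_space"
    unfolding env_space_def
    by (rule measurable_compose[OF measurable_fst c], rule measurable_compose[OF measurable_snd c])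
  then show "(\<lambda>x. fst x 1) \<in> borel_measurable \<mu>" "(\<lambda>x. snd x 1) \<in> borel_measurable \<mu>"
    using assms by (simp_all cong: measurable_cong_sets)
qed

section \<open>The shape function at a critical point\<close>

lemma bulk_limit_of_last_passage:
  assumes pos: "\<And>i j. a (Suc i) + b (Suc j) > 0" and st: "s > 0" "t > 0"
    and lim: "AE W in quenched_law a b.
      (\<lambda>n. ereal (last_passage W (grid s n) (grid t n) / real n)) \<longlonglongrightarrow> \<gamma>"
  shows "AE X in seed_law. (\<lambda>n. ereal (lpp (bulk_weights (\<lambda>(i, j). X (i, j) / (a i + b j)))
        (grid s n) (grid t n) / real n)) \<longlonglongrightarrow> \<gamma>"
proof -
  let ?W = "\<lambda>X. \<lambda>(i, j)\<in>{1..} \<times> {1..}. X (i, j) / (a i + b j) :: real"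
  have pos': "a i + b j > 0" if "i \<ge> 1" "j \<ge> 1" for i j
    using pos[of "i - 1" "j - 1"] that by simp
  have W: "?W \<in> seed_law \<rightarrow>\<^sub>M weight_space"
    unfolding weight_space_def case_prod_beta' by (rule measurable_restrict) measurable
  have "quenched_law a b = distr seed_law weight_space ?W"
    by (rule quenched_law_eq_distr) (rule pos')
  with lim have "AE W in distr seed_law weight_space ?W.
      (\<lambda>n. ereal (last_passage W (grid s n) (grid t n) / real n)) \<longlonglongrightarrow> \<gamma>"
    by (simp only:)
  from AE_distrD[OF W this]
  have "AE X in seed_law. (\<lambda>n. ereal (last_passage (?W X) (grid s n) (grid t n) / real n)) \<longlonglongrightarrow> \<gamma>" .
  then show ?thesis using AE_seed_nonneg
  proof eventually_elim
    case (elim X)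
    have eq: "bulk_weights (?W X) = bulk_weights (\<lambda>(i, j). X (i, j) / (a i + b j))"
      by (auto simp: bulk_weights_def fun_eq_iff)
    have nn: "0 \<le> ?W X (Suc i, Suc j)" for i j
      using elim(2) pos[of i j] by simp
    have "\<forall>\<^sub>F n in sequentially. 1 \<le> grid s n" "\<forall>\<^sub>F n in sequentially. 1 \<le> grid t n"
      using grid_at_top[OF st(1)] grid_at_top[OF st(2)] by (auto simp: filterlim_at_top)
    then have "\<forall>\<^sub>F n in sequentially. ereal (last_passage (?W X) (grid s n) (grid t n) / real n)
        = ereal (lpp (bulk_weights (\<lambda>(i, j). X (i, j) / (a i + b j))) (grid s n) (grid t n) / real n)"
      by eventually_elim (simp only: last_passage_eq_lpp[of "?W X", OF nn] eq)
    with elim(1) show ?case by (rule Lim_transform_eventually)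
  qed
qed

text \<open>
  Let \<open>f\<close> be the growth rate of the stationary model as a function of its parameter. Since
  \<open>f' z = 0\<close> while \<open>A' z < 0 < B' z\<close>, parameters close enough to \<open>z\<close> on its left and right satisfy the two
  conditions of \<open>quenched_bounds\<close> for any prescribed \<open>\<epsilon> > 0\<close>: the change of \<open>f\<close> is of second order,
  the gain on the boundary of first order. As \<open>g s t\<close> is deterministic, one typical environment
  suffices for each \<open>\<epsilon>\<close>.
\<close>

theorem shape_at_critical_point:
  assumes c: "c > 0" "l > 0" "m > 0" and model: "exponential_model \<mu>"
    and row: "row_marginal \<mu> = uniform_measure lborel {c..c + l}"
    and col: "column_marginal \<mu> = uniform_measure lborel {c..c + m}"
    and g: "is_shape_function \<mu> g" and st: "s > 0" "t > 0"
    and z: "- c < z" "z < c"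
    and crit: "s / ((c + z) * (c + l + z)) = t / ((c - z) * (c + m - z))"
  shows "g s t = ereal (s * (ln ((c + l + z) / (c + z)) / l) + t * (ln ((c + m - z) / (c - z)) / m))"
proof -
  define A where "A w = ln ((c + l + w) / (c + w)) / l" for w
  define B where "B w = ln ((c + m - w) / (c - w)) / m" for w
  let ?f = "\<lambda>w. s * A w + t * B w"
  interpret \<mu>: prob_space \<mu> using model by (simp add: exponential_model_def)
  have S: "sets \<mu> = sets env_space" using model by (simp add: exponential_model_def)
  let ?T = "map_prod (shift 1) (shift 1) :: (nat \<Rightarrow> real) \<times> (nat \<Rightarrow> real) \<Rightarrow> _"
  have T: "ergodic_map \<mu> ?T" using model by (simp add: exponential_model_def totally_ergodic_def)
  have Da: "DERIV A z :> - 1 / ((c + z) * (c + l + z))"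
    unfolding A_def[abs_def] using z c
    by (auto intro!: derivative_eq_intros simp: divide_simps)
  have Db: "DERIV B z :> 1 / ((c - z) * (c + m - z))"
    unfolding B_def[abs_def] using z c
    by (auto intro!: derivative_eq_intros simp: divide_simps)
  have Df: "DERIV ?f z :> 0"
    using DERIV_add[OF DERIV_cmult[OF Da, of s] DERIV_cmult[OF Db, of t]] crit by simp
  have bounds: "ereal (?f z - \<epsilon> * (A z + B z)) \<le> g s t \<and> g s t \<le> ereal (?f z)" if e: "\<epsilon> > 0" for \<epsilon>
  proof -
    have "DERIV (\<lambda>w. ?f w - \<epsilon> * A w) z :> 0 - \<epsilon> * (- 1 / ((c + z) * (c + l + z)))"
      by (intro DERIV_diff Df DERIV_cmult Da)
    moreover have "0 - \<epsilon> * (- 1 / ((c + z) * (c + l + z))) > 0" using e z c by simp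
    ultimately obtain d1 where d1: "d1 > 0" "\<And>h. 0 < h \<Longrightarrow> h < d1 \<Longrightarrow> ?f (z - h) - \<epsilon> * A (z - h) < ?f z - \<epsilon> * A z"
      by (blast dest: DERIV_pos_inc_left)
    have "DERIV (\<lambda>w. ?f w - \<epsilon> * B w) z :> 0 - \<epsilon> * (1 / ((c - z) * (c + m - z)))"
      by (intro DERIV_diff Df DERIV_cmult Db)
    moreover have "0 - \<epsilon> * (1 / ((c - z) * (c + m - z))) < 0" using e z c by simp
    ultimately obtain d2 where d2: "d2 > 0" "\<And>h. 0 < h \<Longrightarrow> h < d2 \<Longrightarrow> ?f (z + h) - \<epsilon> * B (z + h) < ?f z - \<epsilon> * B z"
      by (blast dest: DERIV_neg_dec_right)
    \<comment> \<open>Halved so that all five strict inequalities below hold; the last two keep the boundary rates positive.\<close>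
    define h where "h = min (min d1 d2) (min (c + z) (c - z)) / 2"
    have h: "0 < h" "h < d1" "h < d2" "h < c + z" "h < c - z"
      using d1(1) d2(1) z by (auto simp: h_def min_def)
    let ?z1 = "z - h" and ?z2 = "z + h"
    let ?Z = "{z, ?z1, ?z2}"
    have Zc: "c + w > 0" "c - w > 0" if "w \<in> ?Z" for w using that h z by auto
    have rowD: "distr \<mu> borel (\<lambda>x. fst x 1) = uniform_measure lborel {c..c + l}"
      using row by (simp add: row_marginal_def case_prod_beta')
    have colD: "distr \<mu> borel (\<lambda>x. snd x 1) = uniform_measure lborel {c..c + m}"
      using col by (simp add: column_marginal_def case_prod_beta')
    have AEa: "AE x in \<mu>. (\<forall>i. c \<le> fst x (Suc i)) \<and> (\<forall>w\<in>?Z.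
       (\<lambda>n. (\<Sum>i<n. 1 / (fst x (Suc i) + w)) / real n) \<longlonglongrightarrow> ln ((c + l + w) / (c + w)) / l)"
      using ergodic_observable_reciprocal[OF \<mu>.prob_space_axioms T first_entries_measurable(1)[OF S]
          rowD c(2) _ Zc(1), of ?Z]
      by (simp only: funpow_map_prod_shift finite_insert finite.emptyI)
    have Zm: "c + w > 0" if "w \<in> uminus ` ?Z" for w
    proof -
      from that obtain v where "v \<in> ?Z" "w = - v" by blast
      then show ?thesis using Zc(2)[of v] by simp
    qed
    have AEb: "AE x in \<mu>. (\<forall>i. c \<le> snd x (Suc i)) \<and> (\<forall>w\<in>uminus ` ?Z.
       (\<lambda>n. (\<Sum>i<n. 1 / (snd x (Suc i) + w)) / real n) \<longlonglongrightarrow> ln ((c + m + w) / (c + w)) / m)"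
      using ergodic_observable_reciprocal[OF \<mu>.prob_space_axioms T first_entries_measurable(2)[OF S]
          colD c(3) _ Zm, of "uminus ` ?Z"]
      by (simp only: funpow_map_prod_shift finite_imageI finite_insert finite.emptyI)
    have "AE W in annealed_law \<mu>. (\<lambda>n. ereal (last_passage W (grid s n) (grid t n) / real n)) \<longlonglongrightarrow> g s t"
      using g st unfolding is_shape_function_def grid_def by (auto elim: eventually_mono)
    note Q = AE_annealed_imp_AE_quenched[OF \<mu>.prob_space_axioms S this]
    let ?good = "\<lambda>a b. (\<forall>i. c \<le> a (Suc i)) \<and> (\<forall>j. c \<le> b (Suc j))
       \<and> (\<forall>w\<in>?Z. (\<lambda>n. (\<Sum>i<n. 1 / (a (Suc i) + w)) / real n) \<longlonglongrightarrow> A w)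
       \<and> (\<forall>w\<in>?Z. (\<lambda>n. (\<Sum>j<n. 1 / (b (Suc j) - w)) / real n) \<longlonglongrightarrow> B w)
       \<and> (AE W in quenched_law a b. (\<lambda>n. ereal (last_passage W (grid s n) (grid t n) / real n)) \<longlonglongrightarrow> g s t)"
    from Q AEa AEb have "AE x in \<mu>. \<exists>a b. ?good a b"
    proof eventually_elim
      case (elim x)
      have "?good (fst x) (snd x)"
      proof (intro conjI ballI)
        fix w assume w: "w \<in> ?Z"
        then show "(\<lambda>n. (\<Sum>i<n. 1 / (fst x (Suc i) + w)) / real n) \<longlonglongrightarrow> A w"
          using elim(2) unfolding A_def by blast
        from w have "- w \<in> uminus ` ?Z" by blast
        from bspec[OF conjunct2[OF elim(3)] this]
        show "(\<lambda>n. (\<Sum>j<n. 1 / (snd x (Suc j) - w)) / real n) \<longlonglongrightarrow> B w"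
          by (simp only: add_uminus_conv_diff B_def)
      qed (use elim in \<open>auto simp: case_prod_beta'\<close>)
      then show ?case by blast
    qed
    then obtain a b where ab: "\<And>i. c \<le> a (Suc i)" "\<And>j. c \<le> b (Suc j)"
       and Alim: "\<And>w. w \<in> ?Z \<Longrightarrow> (\<lambda>n. (\<Sum>i<n. 1 / (a (Suc i) + w)) / real n) \<longlonglongrightarrow> A w"
       and Blim: "\<And>w. w \<in> ?Z \<Longrightarrow> (\<lambda>n. (\<Sum>j<n. 1 / (b (Suc j) - w)) / real n) \<longlonglongrightarrow> B w"
       and QL: "AE W in quenched_law a b. (\<lambda>n. ereal (last_passage W (grid s n) (grid t n) / real n)) \<longlonglongrightarrow> g s t"
      by (subst (asm) \<mu>.AE_const) blast
    have bulk: "AE X in seed_law. (\<lambda>n. ereal (lpp (bulk_weights (\<lambda>(i, j). X (i, j) / (a i + b j)))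
        (grid s n) (grid t n) / real n)) \<longlonglongrightarrow> g s t"
    proof (rule bulk_limit_of_last_passage[OF _ st QL])
      show "a (Suc i) + b (Suc j) > 0" for i j using ab(1)[of i] ab(2)[of j] c by linarith
    qed
    define d where "d = min (c + z - h) (c - z - h)"
    show ?thesis
    proof (intro conjI)
      have 1: "d > 0" using h by (simp add: d_def)
      have 2: "d \<le> a (Suc i) + w" if "w \<in> ?Z" for i w
        using that ab(1)[of i] h by (auto simp: d_def)
      have 3: "d \<le> b (Suc j) - w" if "w \<in> ?Z" for j w
        using that ab(2)[of j] h by (auto simp: d_def)
      have 4: "?z1 < z" "z < ?z2" using h by auto
      have 5: "?f ?z1 - \<epsilon> * (A ?z1 - A z) < ?f z" using d1(2)[of h] h by (simp add: algebra_simps)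
      have 6: "?f ?z2 - \<epsilon> * (B ?z2 - B z) < ?f z" using d2(2)[of h] h by (simp add: algebra_simps)
      note qb = quenched_bounds[where d=d and z=z and z'="?z1" and z''="?z2" and a=a and b=b and A=A and B=B
          and s=s and t=t and \<epsilon>=\<epsilon> and \<gamma>="g s t", OF 1 2 3 4 Alim Blim st e 5 6 bulk]
      show "ereal (?f z - \<epsilon> * (A z + B z)) \<le> g s t" by (rule qb(1))
      show "g s t \<le> ereal (?f z)" by (rule qb(2))
    qed
  qed
  have "(\<lambda>k. ?f z - 1 / real (Suc k) * (A z + B z)) \<longlonglongrightarrow> ?f z - 0 * (A z + B z)"
    by (intro tendsto_intros LIMSEQ_inverse_real_of_nat[unfolded inverse_eq_divide])
  then have "(\<lambda>k. ereal (?f z - 1 / real (Suc k) * (A z + B z))) \<longlonglongrightarrow> ereal (?f z)"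
    by (intro tendsto_ereal) simp
  moreover have "ereal (?f z - 1 / real (Suc k) * (A z + B z)) \<le> g s t" for k
    by (rule conjunct1[OF bounds]) simp
  then have "\<exists>N. \<forall>k\<ge>N. ereal (?f z - 1 / real (Suc k) * (A z + B z)) \<le> g s t" by blast
  ultimately have "ereal (?f z) \<le> g s t" by (rule LIMSEQ_le_const2)
  with bounds[of 1] show ?thesis by (simp add: A_def B_def)
qed

text \<open>
  With \<open>y = lam / 2 + z\<close> and \<open>Q = lam / y - 1\<close>, the critical equation becomes the quadratic
  \<open>s (lam + m) Q\<^sup>2 = (t l - s m) Q + t (lam + l)\<close>, whose positive root and its reciprocal \<open>Q'\<close> are the two
  fractions in the formula.
\<close>

theorem mainTheorem8:
  fixes \<mu> :: "((nat \<Rightarrow> real) \<times> (nat \<Rightarrow> real)) measure"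
    and g :: "real \<Rightarrow> real \<Rightarrow> ereal"
    and lam l m s t :: real
  assumes "lam > 0" "l > 0" "m > 0"
    and "exponential_model \<mu>"
    and "row_marginal \<mu> = uniform_measure lborel {lam / 2 .. lam / 2 + l}"
    and "column_marginal \<mu> = uniform_measure lborel {lam / 2 .. lam / 2 + m}"
    and "is_shape_function \<mu> g"
    and "s > 0" "t > 0"
  shows "g s t = ereal (
      s / l * ln (1 + l / lam + l / lam *
        ((l * t - m * s + sqrt ((l * t - m * s)\<^sup>2 + 4 * s * t * (lam + l) * (lam + m)))
          / (2 * s * (lam + m))))
    + t / m * ln (1 + m / lam + m / lam *
        ((m * s - l * t + sqrt ((l * t - m * s)\<^sup>2 + 4 * s * t * (lam + l) * (lam + m)))
          / (2 * t * (lam + l)))))"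
proof -
  define R where "R = sqrt ((l * t - m * s)\<^sup>2 + 4 * s * t * (lam + l) * (lam + m))"
  define Q where "Q = (l * t - m * s + R) / (2 * s * (lam + m))"
  define Q' where "Q' = (m * s - l * t + R) / (2 * t * (lam + l))"
  note pos = assms(1-3,8,9)
  have p4: "0 < 4 * s * t * (lam + l) * (lam + m)" using pos by simp
  then have R2: "R\<^sup>2 = (l * t - m * s)\<^sup>2 + 4 * s * t * (lam + l) * (lam + m)"
    unfolding R_def by (intro real_sqrt_pow2) (simp add: add_nonneg_pos less_imp_le)
  have "\<bar>l * t - m * s\<bar> < R"
    unfolding R_def using p4 by (intro real_less_rsqrt) simp
  then have Qpos: "Q > 0" unfolding Q_def using pos by (intro divide_pos_pos mult_pos_pos) auto
  have QQ': "Q * Q' = 1"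
  proof -
    have "(l * t - m * s + R) * (m * s - l * t + R) = 4 * s * t * (lam + l) * (lam + m)"
      using R2 by (simp add: power2_eq_square algebra_simps)
    moreover have "Q * Q' = ((l * t - m * s + R) * (m * s - l * t + R)) / ((2 * s * (lam + m)) * (2 * t * (lam + l)))"
      unfolding Q_def Q'_def by (rule times_divide_times_eq)
    ultimately have "Q * Q' = (4 * s * t * (lam + l) * (lam + m)) / ((2 * s * (lam + m)) * (2 * t * (lam + l)))"
      by (simp only:)
    also have "4 * s * t * (lam + l) * (lam + m) = (2 * s * (lam + m)) * (2 * t * (lam + l))"
      by (simp add: algebra_simps)
    finally show ?thesis using pos by simp
  qed
  have quad: "s * (lam + m) * Q\<^sup>2 = (t * l - s * m) * Q + t * (lam + l)"
  proof -
    have R': "R = 2 * s * (lam + m) * Q - (l * t - m * s)" unfolding Q_def using pos by simp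
    have "4 * s * (lam + m) * (s * (lam + m) * Q\<^sup>2) = 4 * s * (lam + m) * ((t * l - s * m) * Q + t * (lam + l))"
      using R2 unfolding R' by (simp add: power2_eq_square algebra_simps)
    moreover have "4 * s * (lam + m) \<noteq> 0" using pos by simp
    ultimately show ?thesis by simp
  qed
  define y where "y = lam / (1 + Q)"
  have y: "0 < y" "y < lam" and y': "lam - y = lam * Q / (1 + Q)"
    using pos Qpos by (auto simp: y_def field_simps)
  have crit: "s / (y * (y + l)) = t / ((lam - y) * (lam - y + m))"
  proof -
    have "s * ((lam - y) * (lam - y + m)) * (1 + Q)\<^sup>2 = s * (lam * Q * (lam * Q + m * (1 + Q)))"
      using Qpos unfolding y' by (simp add: power2_eq_square divide_simps)
    also have "\<dots> = lam * Q * (s * (lam + m) * Q\<^sup>2 + s * m * Q) / Q"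
      using Qpos by (simp add: power2_eq_square field_simps)
    also have "\<dots> = t * (lam * (lam + l * (1 + Q)))"
      unfolding quad using Qpos by (simp add: field_simps)
    also have "\<dots> = t * (y * (y + l)) * (1 + Q)\<^sup>2"
      using Qpos unfolding y_def by (simp add: power2_eq_square divide_simps)
    finally have "s * ((lam - y) * (lam - y + m)) = t * (y * (y + l))" using Qpos by simp
    then show ?thesis using y pos by (simp add: frac_eq_eq)
  qed
  have "g s t = ereal (s * (ln ((lam / 2 + l + (y - lam / 2)) / (lam / 2 + (y - lam / 2))) / l)
      + t * (ln ((lam / 2 + m - (y - lam / 2)) / (lam / 2 - (y - lam / 2))) / m))"
  proof (rule shape_at_critical_point[where c="lam / 2", OF _ assms(2-9)])
    show "s / ((lam / 2 + (y - lam / 2)) * (lam / 2 + l + (y - lam / 2)))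
      = t / ((lam / 2 - (y - lam / 2)) * (lam / 2 + m - (y - lam / 2)))"
      using crit by (simp add: algebra_simps)
  qed (use y pos in auto)
  also have "(lam / 2 + l + (y - lam / 2)) / (lam / 2 + (y - lam / 2)) = 1 + l / lam + l / lam * Q"
  proof -
    have "(lam / 2 + l + (y - lam / 2)) / (lam / 2 + (y - lam / 2)) = (y + l) / y" by simp
    also have "\<dots> = 1 + l / y" using y by (simp add: field_simps)
    also have "\<dots> = 1 + l / lam + l / lam * Q" unfolding y_def using pos Qpos by (simp add: field_simps)
    finally show ?thesis .
  qed
  also have "(lam / 2 + m - (y - lam / 2)) / (lam / 2 - (y - lam / 2)) = 1 + m / lam + m / lam * Q'"
  proof -
    have "(lam / 2 + m - (y - lam / 2)) / (lam / 2 - (y - lam / 2)) = (lam - y + m) / (lam - y)" by simp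
    also have "\<dots> = 1 + m / (lam - y)" using y by (simp add: field_simps)
    also have "\<dots> = 1 + m * (1 + Q) / (lam * Q)" unfolding y' by simp
    also have "\<dots> = 1 + m / lam + m / lam * (1 / Q)" using pos Qpos by (simp add: field_simps)
    also have "1 / Q = Q'" using QQ' Qpos by (simp add: field_simps)
    finally show ?thesis .
  qed
  finally show ?thesis unfolding Q_def Q'_def R_def by simp
qed

end
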